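(* Let $\varepsilon,\mu\in\{1,-1\}$. A complete set of representatives of the equivalence classes of irreducible projective representations (spin IRs) of $G$ of spin type $\chi_{\varepsilon,\mu}$, that is, of irreducible complex linear representations $\Pi$ of $R(G)$ with $\Pi(z_{12})=\omega^{\varepsilon}I$ and $\Pi(z_{23})=\omega^{\mu}I$, is given by $\Pi_{\varepsilon,\mu;s}$, $s=0,1,2$ (mod $3$).
   Context: Representations are finite-dimensional over $\mathbb{C}$, "IR" means irreducible representation, $\omega=\exp(2\pi i/3)$, and $[x,y]=xyx^{-1}y^{-1}$. $G$ is the group of order 27 generated by $x_1,x_2,x_3$ with relations $x_1^3=x_2^3=x_3^3=1$, $x_2$ central, $[x_1,x_3]=x_2$. Its Schur multiplier is $M(G)\cong \mathbb{Z}_3\times\mathbb{Z}_3$. $R(G)$ is the representation group of $G$ of order 243 with generators $\eta_1,\eta_2,\eta_3,z_{12},z_{23}$ and relations: $z_{12},z_{23}$ central with $z_{12}^3=z_{23}^3=1$; $\eta_j^3=1$ ($j=1,2,3$); $\eta_2\eta_1\eta_2^{-1}=z_{12}^{-1}\eta_1$; $\eta_3\eta_1\eta_3^{-1}=z_{12}\eta_1\eta_2^2$; $\eta_3\eta_2\eta_3^{-1}=z_{23}^{-1}\eta_2$. Every element is uniquely $z_{12}^{\beta_1}z_{23}^{\beta_2}\eta_1^{\gamma_1}\eta_2^{\gamma_2}\eta_3^{\gamma_3}$ with exponents mod 3. The subgroup $M(G)=\langle z_{12}\rangle\times\langle z_{23}\rangle$ is central and $R(G)/M(G)\cong G$ via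 $\eta_j\mapsto x_j$. Irreducible projective representations of $G$ are given by IRs $\Pi$ of $R(G)$; the spin type of $\Pi$ is the character $\chi$ of $M(G)$ with $\Pi(z)=\chi(z)I$ ($z\in M(G)$). Write $\chi_{\varepsilon,\mu}$ for the character with $\chi_{\varepsilon,\mu}(z_{12})=\omega^\varepsilon$, $\chi_{\varepsilon,\mu}(z_{23})=\omega^\mu$. One has $R(G)=\widetilde U\rtimes W$ with $\widetilde U=\langle z_{12},\eta_1,\eta_2\rangle\times\langle z_{23}\rangle$ (order 81) and $W=\langle w\rangle$, $w=\eta_3$. Let $\rho=P_{\varepsilon,\mu}$ be the IR of $\widetilde U$ on $\mathbb{C}^3$ given by $\rho(z_{12})=\omega^{\varepsilon}I$, $\rho(z_{23})=\omega^{\mu}I$, $\rho(\eta_1)=\mathrm{diag}(1,\omega^{-\varepsilon},\omega^{\varepsilon})$, $\rho(\eta_2)=J$, where $$J=\begin{bmatrix}0&1&0\\0&0&1\\1&0&0\end{bmatrix}.$$ Let $J_\rho(w)$ be a fixed invertible $3\times3$ matrix with $\rho(wuw^{-1})J_\rho(w)=J_\rho(w)\rho(u)$ for all $u\in \widetilde U$, normalized by $J_\rho(w)^3=I$ (so that $w^k\mapsto J_\rho(w)^k$ is a linear representation of $W$). For $s\in\{0,1,2\}$, $\Pi_{\varepsilon,\mu;s}$ is the representation of $R(G)$ on $\mathbb{C}^3$ defined by $\Pi_{\varepsilon,\mu;s}(u\,w^k)=\omega^{sk}\rho(u)J_\rho(w)^k$ ($u\in\widetilde U$, $0\le k\le 2$).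 *)

theory Defs
  imports "Jordan_Normal_Form.VS_Connect" "HOL-Algebra.Generated_Groups"
begin

definition GL :: "nat \<Rightarrow> complex mat monoid" where
  "GL n = units_of (ring_mat TYPE(complex) n ())"

text \<open>A finite-dimensional complex representation is taken to be a matrix representation
  on \<open>\<complex>\<^sup>n\<close>; its values outside the carrier of the group are irrelevant.\<close>

definition is_rep :: "('g, 'b) monoid_scheme \<Rightarrow> nat \<Rightarrow> ('g \<Rightarrow> complex mat) \<Rightarrow> bool" where
  "is_rep G n \<Phi> \<longleftrightarrow> \<Phi> \<in> hom G (GL n)"

definition irreducible_rep :: "('g, 'b) monoid_scheme \<Rightarrow> nat \<Rightarrow> ('g \<Rightarrow> complex mat) \<Rightarrow> bool" where
  "irreducible_rep G n \<Phi> \<longleftrightarrow> is_rep G n \<Phi> \<and> n > 0 \<and>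
     (\<forall>W. VectorSpace.subspace class_ring W (module_vec TYPE(complex) n) \<longrightarrow>
          (\<forall>g \<in> carrier G. \<forall>v \<in> W. \<Phi> g *\<^sub>v v \<in> W) \<longrightarrow>
          W = {0\<^sub>v n} \<or> W = carrier_vec n)"

definition equivalent_reps ::
  "('g, 'b) monoid_scheme \<Rightarrow> nat \<Rightarrow> ('g \<Rightarrow> complex mat) \<Rightarrow> nat \<Rightarrow> ('g \<Rightarrow> complex mat) \<Rightarrow> bool" where
  "equivalent_reps G n \<Phi> m \<Phi>' \<longleftrightarrow>
     n = m \<and> (\<exists>T \<in> carrier (GL n). \<forall>g \<in> carrier G. T * \<Phi> g = \<Phi>' g * T)"

definition omega :: complex ("\<omega>") where
  "\<omega> = exp (2 * complex_of_real pi * \<i> / 3)"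

text \<open>The relations present a group of order 243, so a group generated by elements satisfying
  them is isomorphic to the presented group exactly if it has this order.\<close>

locale representation_group = group R for R (structure) +
  fixes z12 z23 \<eta>1 \<eta>2 \<eta>3 :: 'a
  assumes gens_closed: "{z12, z23, \<eta>1, \<eta>2, \<eta>3} \<subseteq> carrier R"
    and generated: "generate R {z12, z23, \<eta>1, \<eta>2, \<eta>3} = carrier R"
    and order_R: "Coset.order R = 243"
    and z12_central: "x \<in> carrier R \<Longrightarrow> z12 \<otimes> x = x \<otimes> z12"
    and z23_central: "x \<in> carrier R \<Longrightarrow> z23 \<otimes> x = x \<otimes> z23"
    and z_cubes: "z12 [^] (3::nat) = \<one>" "z23 [^] (3::nat) = \<one>"
    and \<eta>_cubes: "\<eta>1 [^] (3::nat) = \<one>" "\<eta>2 [^] (3::nat) = \<one>" "\<eta>3 [^] (3::nat) = \<one>"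
    and rel21: "\<eta>2 \<otimes> \<eta>1 \<otimes> inv \<eta>2 = inv z12 \<otimes> \<eta>1"
    and rel31: "\<eta>3 \<otimes> \<eta>1 \<otimes> inv \<eta>3 = z12 \<otimes> \<eta>1 \<otimes> \<eta>2 [^] (2::nat)"
    and rel32: "\<eta>3 \<otimes> \<eta>2 \<otimes> inv \<eta>3 = inv z23 \<otimes> \<eta>2"

definition spin_IR ::
  "('g, 'b) monoid_scheme \<Rightarrow> 'g \<Rightarrow> 'g \<Rightarrow> int \<Rightarrow> int \<Rightarrow> nat \<Rightarrow> ('g \<Rightarrow> complex mat) \<Rightarrow> bool" where
  "spin_IR R z12 z23 \<epsilon> \<mu> n \<Phi> \<longleftrightarrow> irreducible_rep R n \<Phi> \<and>
     \<Phi> z12 = (\<omega> powi \<epsilon>) \<cdot>\<^sub>m 1\<^sub>m n \<and> \<Phi> z23 = (\<omega> powi \<mu>) \<cdot>\<^sub>m 1\<^sub>m n"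

definition U_tilde :: "('g, 'b) monoid_scheme \<Rightarrow> 'g \<Rightarrow> 'g \<Rightarrow> 'g \<Rightarrow> 'g \<Rightarrow> 'g set" where
  "U_tilde R z12 z23 \<eta>1 \<eta>2 = generate R {z12, \<eta>1, \<eta>2, z23}"

definition shift_mat :: "complex mat" where
  "shift_mat = mat_of_rows_list 3 [[0, 1, 0], [0, 0, 1], [1, 0, 0]]"

text \<open>The values on the generators determine \<open>\<rho>\<close> on \<open>U_tilde\<close> and force it to be irreducible
  when \<open>\<epsilon>\<close> is not divisible by 3.\<close>

definition is_P ::
  "('g, 'b) monoid_scheme \<Rightarrow> 'g \<Rightarrow> 'g \<Rightarrow> 'g \<Rightarrow> 'g \<Rightarrow> int \<Rightarrow> int \<Rightarrow> ('g \<Rightarrow> complex mat) \<Rightarrow> bool" where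
  "is_P R z12 z23 \<eta>1 \<eta>2 \<epsilon> \<mu> \<rho> \<longleftrightarrow>
     is_rep (R\<lparr>carrier := U_tilde R z12 z23 \<eta>1 \<eta>2\<rparr>) 3 \<rho> \<and>
     \<rho> z12 = (\<omega> powi \<epsilon>) \<cdot>\<^sub>m 1\<^sub>m 3 \<and>
     \<rho> z23 = (\<omega> powi \<mu>) \<cdot>\<^sub>m 1\<^sub>m 3 \<and>
     \<rho> \<eta>1 = mat_diag 3 (\<lambda>i. [1, \<omega> powi (- \<epsilon>), \<omega> powi \<epsilon>] ! i) \<and>
     \<rho> \<eta>2 = shift_mat"

definition is_J ::
  "('g, 'b) monoid_scheme \<Rightarrow> 'g set \<Rightarrow> 'g \<Rightarrow> ('g \<Rightarrow> complex mat) \<Rightarrow> complex mat \<Rightarrow> bool" where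
  "is_J R U w \<rho> Jw \<longleftrightarrow> Jw \<in> carrier (GL 3) \<and>
     (\<forall>u \<in> U. \<rho> (w \<otimes>\<^bsub>R\<^esub> u \<otimes>\<^bsub>R\<^esub> inv\<^bsub>R\<^esub> w) * Jw = Jw * \<rho> u) \<and>
     Jw ^\<^sub>m 3 = 1\<^sub>m 3"

text \<open>Every element of \<open>R(G)\<close> is \<open>u w\<^sup>k\<close> for exactly one \<open>u\<close> in \<open>U_tilde\<close> and \<open>k \<le> 2\<close>,
  so the description below is definite.\<close>

definition Pi_rep ::
  "('g, 'b) monoid_scheme \<Rightarrow> 'g set \<Rightarrow> 'g \<Rightarrow> ('g \<Rightarrow> complex mat) \<Rightarrow> complex mat \<Rightarrow> nat \<Rightarrow>
   'g \<Rightarrow> complex mat" where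
  "Pi_rep R U w \<rho> Jw s x =
     (THE A. \<exists>u \<in> U. \<exists>k \<le> 2. x = u \<otimes>\<^bsub>R\<^esub> w [^]\<^bsub>R\<^esub> (k::nat) \<and>
        A = \<omega> ^ (s * k) \<cdot>\<^sub>m (\<rho> u * Jw ^\<^sub>m k))"

end

theory Submission
  imports Defs
begin

text \<open>The representations are constructed and classified by Clifford theory for the subgroup \<open>U\<close> of
  index 3, with complement generated by \<open>\<eta>3\<close>.

  Group theory. Adjoining the generators one by one shows that \<open>U\<close> has at most 81 elements and that
  every element of \<open>R\<close> is some \<open>u \<eta>3\<^sup>k\<close> with \<open>k < 3\<close>. Since \<open>R\<close> has order 243, the factorization is
  unique (\<open>decomposition\<close>). Consequently a matrix \<open>B\<close> of order dividing 3 that implements the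
  conjugation by \<open>\<eta>3\<close> on \<open>\<rho>\<close> extends \<open>\<rho>\<close> to \<open>R\<close> by \<open>u \<eta>3\<^sup>k \<mapsto> \<rho>(u) B\<^sup>k\<close>
  (\<open>extension_is_rep\<close>). Taking \<open>B = \<omega>\<^sup>s J\<close> gives the three representations of the theorem.

  Irreducibility and inequivalence. Already \<open>\<rho>(\<eta>1)\<close> and \<open>\<rho>(\<eta>2)\<close> have no common invariant subspace
  and only scalars commute with both (\<open>clock_shift_irreducible\<close>, \<open>clock_shift_commutant\<close>). An
  equivalence between two of the extensions commutes with \<open>\<rho>\<close>, hence is a scalar, hence the values
  \<open>\<omega>\<^sup>s J\<close> and \<open>\<omega>\<^sup>t J\<close> at \<open>\<eta>3\<close> agree.

  Completeness. In an irreducible \<open>\<Psi>\<close> of the given spin type, \<open>A = \<Psi>(\<eta>1)\<close> and \<open>B = \<Psi>(\<eta>2)\<close> satisfy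
  \<open>A B = \<zeta> B A\<close> with \<open>\<zeta> = \<omega>\<^sup>\<epsilon>\<close> a primitive cube root of unity. Therefore \<open>B\<close> permutes the
  eigenspaces of \<open>A\<close>, a vector fixed by \<open>A\<close> exists, and it generates a copy of \<open>\<rho>\<close> in the
  restriction of \<open>\<Psi>\<close> to \<open>U\<close>; this yields a nonzero matrix \<open>S\<close> with \<open>\<Psi>(u) S = S \<rho>(u)\<close>. The cyclic
  group generated by \<open>\<eta>3\<close> acts on the space of all such matrices, and an eigenvector for \<open>\<omega>\<^sup>s\<close>
  intertwines \<open>\<Psi>\<close> with the extension of index \<open>s\<close>. Some projection of \<open>S\<close> to an eigenspace is
  nonzero, and by Schur's lemma it is an equivalence.\<close>

section \<open>Adjoining a normalizing element of finite order\<close>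

lemma (in group) conj_generate:
  assumes "A \<subseteq> carrier G" "g \<in> carrier G" "\<And>a. a \<in> A \<Longrightarrow> g \<otimes> a \<otimes> inv g \<in> generate G A"
    and "h \<in> generate G A"
  shows "g \<otimes> h \<otimes> inv g \<in> generate G A"
  using assms(4)
proof (induct h rule: generate.induct)
  case one
  then show ?case using assms(2) by (simp add: generate.one)
next
  case (incl h)
  then show ?case by (rule assms(3))
next
  case (inv h)
  then have h: "h \<in> carrier G" using assms(1) by auto
  have "inv (g \<otimes> h \<otimes> inv g) \<in> generate G A"
    using assms(1) assms(3) inv generate_m_inv_closed by blast
  moreover have "inv (g \<otimes> h \<otimes> inv g) = g \<otimes> inv h \<otimes> inv g"
    using h assms(2) by (simp add: inv_mult_group m_assoc)
  ultimately show ?case by simp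
next
  case (eng h k)
  have c: "h \<in> carrier G" "k \<in> carrier G"
    using eng generate_in_carrier[OF assms(1)] by auto
  have "g \<otimes> (h \<otimes> k) \<otimes> inv g = (g \<otimes> h \<otimes> inv g) \<otimes> (g \<otimes> k \<otimes> inv g)"
    using c assms(2) by (simp add: inv_solve_left m_assoc)
  then show ?case using generate.eng[OF eng(2,4)] by simp
qed

lemma (in group) conj_pow_closed:
  assumes "H \<subseteq> carrier G" "g \<in> carrier G" "\<And>h. h \<in> H \<Longrightarrow> g \<otimes> h \<otimes> inv g \<in> H"
    and "h \<in> H"
  shows "g [^] (k::nat) \<otimes> h \<otimes> inv (g [^] k) \<in> H"
  using assms(4)
proof (induct k arbitrary: h)
  case 0
  then show ?case using assms(1) by auto
next
  case (Suc k)
  have h: "h \<in> carrier G" using Suc assms(1) by auto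
  have "g [^] Suc k \<otimes> h \<otimes> inv (g [^] Suc k) = g [^] k \<otimes> (g \<otimes> h \<otimes> inv g) \<otimes> inv (g [^] k)"
    using h assms(2) by (simp add: inv_mult_group m_assoc)
  then show ?case using Suc(1)[OF assms(3)[OF Suc(2)]] by simp
qed

lemma (in group) pow_mod:
  assumes "g \<in> carrier G" "g [^] (m::nat) = \<one>"
  shows "g [^] (k::nat) = g [^] (k mod m)"
proof -
  have "g [^] (m * (k div m) + k mod m) = (g [^] m) [^] (k div m) \<otimes> g [^] (k mod m)"
    using assms(1) by (simp add: nat_pow_mult nat_pow_pow)
  then show ?thesis using assms by simp
qed

text \<open>Moving \<open>g\<^sup>k\<close> to the right past \<open>v\<close> conjugates \<open>v\<close>. This is the multiplication rule of a
  semidirect product, and it is also the reason why the extended representation below is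
  multiplicative.\<close>

lemma (in group) mult_pow_move:
  assumes "u \<in> carrier G" "v \<in> carrier G" "g \<in> carrier G"
  shows "(u \<otimes> g [^] (k::nat)) \<otimes> (v \<otimes> g [^] (l::nat))
    = (u \<otimes> (g [^] k \<otimes> v \<otimes> inv (g [^] k))) \<otimes> g [^] (k + l)"
proof -
  have "(u \<otimes> (g [^] k \<otimes> v \<otimes> inv (g [^] k))) \<otimes> g [^] (k + l)
    = u \<otimes> (g [^] k \<otimes> (v \<otimes> (inv (g [^] k) \<otimes> (g [^] k \<otimes> g [^] l))))"
    using assms by (simp add: m_assoc nat_pow_mult)
  also have "inv (g [^] k) \<otimes> (g [^] k \<otimes> g [^] l) = g [^] l"
    using assms by (simp add: inv_solve_left' m_assoc[symmetric])
  finally show ?thesis using assms by (simp add: m_assoc)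
qed

text \<open>When \<open>g\<close> normalizes \<open>\<langle>A\<rangle>\<close>, the products \<open>u g\<^sup>k\<close> already form a subgroup, so adjoining \<open>g\<close>
  multiplies the order by at most \<open>m\<close>. Here \<open>m\<close> is any positive exponent that kills \<open>g\<close>, and the
  factorization need not be unique; uniqueness is later forced by the order of the whole group.\<close>

lemma (in group) generate_insert_normalizing:
  assumes A: "A \<subseteq> carrier G" and g: "g \<in> carrier G"
    and n: "\<And>a. a \<in> A \<Longrightarrow> g \<otimes> a \<otimes> inv g \<in> generate G A"
    and m: "m > 0" "g [^] (m::nat) = \<one>"
  shows "generate G (insert g A) = (\<lambda>(u, k). u \<otimes> g [^] k) ` (generate G A \<times> {..<m})"
    (is "?L = ?R")
proof
  let ?N = "{u \<otimes> g [^] (k::nat) | u k. u \<in> generate G A}"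
  have AC: "generate G A \<subseteq> carrier G" using generate_incl[OF A] .
  have NR: "?N \<subseteq> ?R"
  proof
    fix x assume "x \<in> ?N"
    then obtain u k where "u \<in> generate G A" "x = u \<otimes> g [^] (k::nat)" by auto
    then have "x = u \<otimes> g [^] (k mod m)" "k mod m < m" "u \<in> generate G A"
      using pow_mod[OF g m(2)] m(1) by auto
    then show "x \<in> ?R" by force
  qed
  have cj: "g [^] k \<otimes> h \<otimes> inv (g [^] k) \<in> generate G A" if "h \<in> generate G A" for h and k :: nat
    using conj_pow_closed[OF AC g conj_generate[OF A g n] that] .
  have "subgroup ?N G"
  proof
    show "?N \<subseteq> carrier G" using AC g by auto
    show "\<one> \<in> ?N" by (intro CollectI exI[of _ "\<one>"] exI[of _ "0::nat"]) (auto intro: generate.one)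
  next
    fix x y assume "x \<in> ?N" "y \<in> ?N"
    then obtain u k v l where x: "u \<in> generate G A" "x = u \<otimes> g [^] (k::nat)"
      and y: "v \<in> generate G A" "y = v \<otimes> g [^] (l::nat)" by auto
    have "x \<otimes> y = (u \<otimes> (g [^] k \<otimes> v \<otimes> inv (g [^] k))) \<otimes> g [^] (k + l)"
      unfolding x(2) y(2) by (rule mult_pow_move) (use x y AC g in auto)
    then show "x \<otimes> y \<in> ?N" using generate.eng[OF x(1) cj[OF y(1)]] by blast
  next
    fix x assume "x \<in> ?N"
    then obtain u k where x: "u \<in> generate G A" "x = u \<otimes> g [^] (k::nat)" by auto
    let ?l = "k * (m - 1)"
    have u: "u \<in> carrier G" using x AC by auto
    have "g [^] ?l \<otimes> g [^] k = g [^] (m * k)"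
      using g m(1) by (simp add: nat_pow_mult algebra_simps diff_mult_distrib2)
    also have "\<dots> = \<one>" using g m(2) by (simp add: nat_pow_pow[symmetric])
    finally have "inv (g [^] k) = g [^] ?l" using g by (simp add: inv_equality)
    then have "inv x = g [^] ?l \<otimes> inv u" using x u g by (simp add: inv_mult_group)
    also have "\<dots> = (\<one> \<otimes> g [^] ?l) \<otimes> (inv u \<otimes> g [^] (0::nat))" using u g by simp
    also have "\<dots> = (\<one> \<otimes> (g [^] ?l \<otimes> inv u \<otimes> inv (g [^] ?l))) \<otimes> g [^] (?l + 0)"
      using u g by (intro mult_pow_move) auto
    finally show "inv x \<in> ?N"
      using generate.eng[OF generate.one cj[OF generate_m_inv_closed[OF A x(1)]]] by blast
  qed
  moreover have "insert g A \<subseteq> ?N"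
  proof
    fix a assume "a \<in> insert g A"
    then have "a = \<one> \<otimes> g [^] (1::nat) \<or> (a \<in> A \<and> a = a \<otimes> g [^] (0::nat))"
      using g A by auto
    then show "a \<in> ?N" using generate.one[of G A] generate.incl[of a A G] by blast
  qed
  ultimately have "?L \<subseteq> ?N" by (intro generate_subgroup_incl)
  with NR show "?L \<subseteq> ?R" by (rule subset_trans[rotated])
next
  show "?R \<subseteq> ?L"
  proof
    fix x assume "x \<in> ?R"
    then obtain u k where x: "u \<in> generate G A" "x = u \<otimes> g [^] (k::nat)" by auto
    have "u \<in> ?L" using x(1) mono_generate[OF subset_insertI] by blast
    moreover have "g [^] k \<in> ?L"
    proof (induct k)
      case 0
      then show ?case by (simp add: generate.one)
    next
      case (Suc k)
      then show ?case by (simp add: generate.eng generate.incl)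
    qed
    ultimately show "x \<in> ?L" using x generate.eng by metis
  qed
qed

lemma (in group) card_generate_insert_normalizing:
  assumes "A \<subseteq> carrier G" "g \<in> carrier G"
    and "\<And>a. a \<in> A \<Longrightarrow> g \<otimes> a \<otimes> inv g \<in> generate G A"
    and "m > 0" "g [^] (m::nat) = \<one>" and "finite (generate G A)"
  shows "finite (generate G (insert g A)) \<and> card (generate G (insert g A)) \<le> card (generate G A) * m"
  using generate_insert_normalizing[OF assms(1-5)] assms(6)
    card_image_le[of "generate G A \<times> {..<m}" "\<lambda>(u, k). u \<otimes> g [^] k"]
  by (simp add: card_cartesian_product)

section \<open>The group of order 243 as a semidirect product\<close>

context representation_group
begin

abbreviation U where "U \<equiv> U_tilde R z12 z23 \<eta>1 \<eta>2"

lemma closed [simp]: "z12 \<in> carrier R" "z23 \<in> carrier R" "\<eta>1 \<in> carrier R" "\<eta>2 \<in> carrier R" "\<eta>3 \<in> carrier R"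
  using gens_closed by auto

lemma subgroup_U: "subgroup U R"
  unfolding U_tilde_def by (rule generate_is_subgroup) auto

lemma gens_in_U: "z12 \<in> U" "z23 \<in> U" "\<eta>1 \<in> U" "\<eta>2 \<in> U"
  unfolding U_tilde_def by (auto intro: generate.incl)

lemma U_closed: "u \<in> U \<Longrightarrow> u \<in> carrier R"
  using subgroup.subset[OF subgroup_U] by auto

lemma conj_central: "g \<in> carrier R \<Longrightarrow> g \<otimes> z12 \<otimes> inv g = z12" "g \<in> carrier R \<Longrightarrow> g \<otimes> z23 \<otimes> inv g = z23"
  by (simp_all add: z12_central[symmetric] z23_central[symmetric] m_assoc)

text \<open>The relation for \<open>\<eta>2 \<eta>1 \<eta>2\<inverse>\<close>, read as a conjugation by \<open>\<eta>1\<close>: it makes \<open>\<eta>1\<close> normalize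
  \<open>\<langle>z12, z23, \<eta>2\<rangle>\<close>.\<close>

lemma conj_\<eta>2: "\<eta>1 \<otimes> \<eta>2 \<otimes> inv \<eta>1 = z12 \<otimes> \<eta>2"
proof -
  have "\<eta>2 \<otimes> \<eta>1 = inv z12 \<otimes> \<eta>1 \<otimes> \<eta>2"
    using rel21 by (metis closed inv_closed inv_solve_right m_closed)
  then have "z12 \<otimes> (\<eta>2 \<otimes> \<eta>1) = \<eta>1 \<otimes> \<eta>2"
    by (simp add: m_assoc[symmetric])
  then show ?thesis by (metis closed(1,3,4) inv_solve_right m_assoc m_closed)
qed

text \<open>Adjoining \<open>z12\<close>, \<open>z23\<close>, \<open>\<eta>2\<close>, \<open>\<eta>1\<close> in this order, each generator normalizes the subgroup
  generated by the previous ones, so each step costs a factor of at most 3.\<close>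

lemma card_U: "finite U \<and> card U \<le> 81"
proof -
  note step = card_generate_insert_normalizing[where m = 3]
  have 0: "generate R {} = {\<one>}" using generate_empty by simp
  have 1: "finite (generate R {z12}) \<and> card (generate R {z12}) \<le> 3"
    using step[of "{}" z12] 0 z_cubes by simp
  have 2: "finite (generate R {z23, z12}) \<and> card (generate R {z23, z12}) \<le> 9"
    using step[of "{z12}" z23] 1 z_cubes conj_central by (fastforce intro: generate.incl)
  have 3: "finite (generate R {\<eta>2, z23, z12}) \<and> card (generate R {\<eta>2, z23, z12}) \<le> 27"
    using step[of "{z23, z12}" \<eta>2] 2 \<eta>_cubes conj_central by (fastforce intro: generate.incl)
  have "z12 \<otimes> \<eta>2 \<in> generate R {\<eta>2, z23, z12}"
    by (intro generate.eng generate.incl) auto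
  then have "\<eta>1 \<otimes> a \<otimes> inv \<eta>1 \<in> generate R {\<eta>2, z23, z12}" if "a \<in> {\<eta>2, z23, z12}" for a
    using that conj_central conj_\<eta>2
    by (auto intro: generate.incl)
  then have 4: "finite (generate R {\<eta>1, \<eta>2, z23, z12}) \<and> card (generate R {\<eta>1, \<eta>2, z23, z12}) \<le> 81"
    using step[of "{\<eta>2, z23, z12}" \<eta>1] 3 \<eta>_cubes by fastforce
  have "{\<eta>1, \<eta>2, z23, z12} = {z12, \<eta>1, \<eta>2, z23}" by auto
  then show ?thesis using 4 unfolding U_tilde_def by metis
qed

lemma conj_gens_in_U: "a \<in> {z12, \<eta>1, \<eta>2, z23} \<Longrightarrow> \<eta>3 \<otimes> a \<otimes> inv \<eta>3 \<in> U"
proof -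
  interpret U: subgroup U R by (rule subgroup_U)
  assume "a \<in> {z12, \<eta>1, \<eta>2, z23}"
  then consider "a = z12" | "a = \<eta>1" | "a = \<eta>2" | "a = z23" by auto
  then show ?thesis
  proof cases
    case 2
    then show ?thesis using rel31 gens_in_U by (simp add: numeral_2_eq_2)
  qed (use conj_central rel32 gens_in_U in auto)
qed

text \<open>Every element has the form \<open>u \<eta>3\<^sup>k\<close> because \<open>\<eta>3\<close> normalizes \<open>U\<close>. There are at most
  \<open>81 * 3 = 243\<close> such pairs and \<open>R\<close> has 243 elements, so no element is hit twice.\<close>

lemma decomposition: "bij_betw (\<lambda>(u, k). u \<otimes> \<eta>3 [^] k) (U \<times> {..<3::nat}) (carrier R)"
proof -
  have e: "insert \<eta>3 {z12, \<eta>1, \<eta>2, z23} = {z12, z23, \<eta>1, \<eta>2, \<eta>3}" by auto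
  have im: "carrier R = (\<lambda>(u, k). u \<otimes> \<eta>3 [^] k) ` (U \<times> {..<3::nat})" (is "_ = ?f ` _")
    using generate_insert_normalizing[of "{z12, \<eta>1, \<eta>2, z23}" \<eta>3 3]
      conj_gens_in_U \<eta>_cubes generated unfolding U_tilde_def e by auto
  have "card (U \<times> {..<3::nat}) \<le> card (?f ` (U \<times> {..<3}))"
    using card_U order_R unfolding im[symmetric] by (simp add: card_cartesian_product Coset.order_def)
  then have "inj_on ?f (U \<times> {..<3})"
    using card_U by (intro eq_card_imp_inj_on antisym card_image_le) auto
  then show ?thesis using im by (simp add: bij_betw_def)
qed

lemma conj_pow_in_U: "u \<in> U \<Longrightarrow> \<eta>3 [^] (k::nat) \<otimes> u \<otimes> inv (\<eta>3 [^] k) \<in> U"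
  by (rule conj_pow_closed)
    (use U_closed conj_generate[of "{z12, \<eta>1, \<eta>2, z23}" \<eta>3] conj_gens_in_U in \<open>auto simp: U_tilde_def\<close>)

end

section \<open>Intertwiners and Schur's lemma\<close>

lemma GL_mult [simp]: "x \<otimes>\<^bsub>GL n\<^esub> y = x * y"
  by (simp add: GL_def units_of_mult ring_mat_simps)

lemma GL_one [simp]: "\<one>\<^bsub>GL n\<^esub> = 1\<^sub>m n"
  by (simp add: GL_def units_of_one ring_mat_simps)

lemma in_GL_iff: "A \<in> carrier (GL n) \<longleftrightarrow>
    A \<in> carrier_mat n n \<and> (\<exists>B \<in> carrier_mat n n. B * A = 1\<^sub>m n \<and> A * B = 1\<^sub>m n)"
  by (simp add: GL_def units_of_carrier Units_def ring_mat_simps)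

lemma group_GL: "group (GL n)"
  unfolding GL_def by (rule monoid.units_group) (rule semiring.axioms(2), rule semiring_mat)

lemma GL_carrier_mat: "A \<in> carrier (GL n) \<Longrightarrow> A \<in> carrier_mat n n"
  by (simp add: in_GL_iff)

lemma rep_carrier: "is_rep G n \<Phi> \<Longrightarrow> x \<in> carrier G \<Longrightarrow> \<Phi> x \<in> carrier_mat n n"
  unfolding is_rep_def by (blast intro: GL_carrier_mat dest: hom_in_carrier)

lemma rep_mult:
  "is_rep G n \<Phi> \<Longrightarrow> x \<in> carrier G \<Longrightarrow> y \<in> carrier G \<Longrightarrow> \<Phi> (x \<otimes>\<^bsub>G\<^esub> y) = \<Phi> x * \<Phi> y"
  unfolding is_rep_def by (simp add: hom_mult)

lemma rep_one: "group G \<Longrightarrow> is_rep G n \<Phi> \<Longrightarrow> \<Phi> \<one>\<^bsub>G\<^esub> = 1\<^sub>m n"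
  unfolding is_rep_def using group_hom.hom_one[of G "GL n" \<Phi>]
  by (simp add: group_hom_def group_hom_axioms_def group_GL)

lemma rep_inv:
  assumes "group G" "is_rep G n \<Phi>" "x \<in> carrier G"
  shows "\<Phi> (inv\<^bsub>G\<^esub> x) * \<Phi> x = 1\<^sub>m n" "\<Phi> x * \<Phi> (inv\<^bsub>G\<^esub> x) = 1\<^sub>m n"
proof -
  interpret group G by fact
  show "\<Phi> (inv\<^bsub>G\<^esub> x) * \<Phi> x = 1\<^sub>m n" "\<Phi> x * \<Phi> (inv\<^bsub>G\<^esub> x) = 1\<^sub>m n"
    using assms(3) rep_mult[OF assms(2), symmetric] rep_one[OF assms(1,2)] by simp_all
qed

definition intertwines ::
  "('g, 'b) monoid_scheme \<Rightarrow> nat \<Rightarrow> ('g \<Rightarrow> complex mat) \<Rightarrow> nat \<Rightarrow> ('g \<Rightarrow> complex mat) \<Rightarrow>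
    complex mat \<Rightarrow> bool" where
  "intertwines G n \<Phi> m \<Psi> S \<longleftrightarrow>
    S \<in> carrier_mat m n \<and> (\<forall>g \<in> carrier G. \<Psi> g * S = S * \<Phi> g)"

text \<open>The elements at which \<open>S\<close> intertwines form a subgroup.\<close>

lemma intertwines_if_on_generators:
  assumes "group G" "is_rep G n \<Phi>" "is_rep G m \<Psi>"
    and S: "S \<in> carrier_mat m n"
    and gen: "H \<subseteq> carrier G" "generate G H = carrier G"
    and H: "\<And>h. h \<in> H \<Longrightarrow> \<Psi> h * S = S * \<Phi> h"
  shows "intertwines G n \<Phi> m \<Psi> S"
proof -
  interpret group G by fact
  note [simp] = rep_carrier[OF assms(2)] rep_carrier[OF assms(3)] S
  have rep1: "\<Phi> \<one>\<^bsub>G\<^esub> = 1\<^sub>m n" "\<Psi> \<one>\<^bsub>G\<^esub> = 1\<^sub>m m"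
    using rep_one[OF assms(1)] assms(2,3) by auto
  have "\<Psi> g * S = S * \<Phi> g" if "g \<in> generate G H" for g
    using that
  proof (induct g rule: generate.induct)
    case one
    then show ?case using rep1 left_mult_one_mat[OF S] right_mult_one_mat[OF S] by simp
  next
    case (incl h)
    then show ?case by (rule H)
  next
    case (inv h)
    then have h: "h \<in> carrier G" using gen by auto
    have "\<Psi> (inv\<^bsub>G\<^esub> h) * S = \<Psi> (inv\<^bsub>G\<^esub> h) * (S * (\<Phi> h * \<Phi> (inv\<^bsub>G\<^esub> h)))"
      unfolding rep_inv(2)[OF assms(1,2) h] right_mult_one_mat[OF S] ..
    also have "S * (\<Phi> h * \<Phi> (inv\<^bsub>G\<^esub> h)) = (S * \<Phi> h) * \<Phi> (inv\<^bsub>G\<^esub> h)"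
      using h by (intro assoc_mult_mat[symmetric, of _ m n _ n _ n]) auto
    also have "\<dots> = (\<Psi> h * S) * \<Phi> (inv\<^bsub>G\<^esub> h)" using H[OF inv] by simp
    also have "\<dots> = \<Psi> h * (S * \<Phi> (inv\<^bsub>G\<^esub> h))"
      using h by (intro assoc_mult_mat[of _ m m _ n _ n]) auto
    also have "\<Psi> (inv\<^bsub>G\<^esub> h) * \<dots> = (\<Psi> (inv\<^bsub>G\<^esub> h) * \<Psi> h) * (S * \<Phi> (inv\<^bsub>G\<^esub> h))"
      using h by (intro assoc_mult_mat[symmetric, of _ m m _ m _ n] mult_carrier_mat[of _ m n _ n]) auto
    also have "\<dots> = S * \<Phi> (inv\<^bsub>G\<^esub> h)"
      unfolding rep_inv(1)[OF assms(1,3) h] using h by (intro left_mult_one_mat[of _ m n] mult_carrier_mat[of _ m n _ n]) auto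
    finally show ?case .
  next
    case (eng h k)
    then have c: "h \<in> carrier G" "k \<in> carrier G" using gen by auto
    have "\<Psi> h * \<Psi> k * S = \<Psi> h * (S * \<Phi> k)"
      using c eng(4) by (simp add: assoc_mult_mat[of _ m m _ m _ n])
    also have "\<dots> = (S * \<Phi> h) * \<Phi> k"
      using c eng(2) by (simp add: assoc_mult_mat[symmetric, of _ m m _ n _ n])
    also have "\<dots> = S * (\<Phi> h * \<Phi> k)" using c by (intro assoc_mult_mat[of _ m n _ n _ n]) auto
    finally show ?case using c rep_mult[OF assms(2)] rep_mult[OF assms(3)] by simp
  qed
  then show ?thesis using gen S by (simp add: intertwines_def)
qed

lemma subspace_iff:
  "VectorSpace.subspace class_ring W (module_vec TYPE('a::field) n) \<longleftrightarrow>
    W \<subseteq> carrier_vec n \<and> 0\<^sub>v n \<in> W \<and> (\<forall>v \<in> W. \<forall>w \<in> W. v + w \<in> W) \<and> (\<forall>c. \<forall>v \<in> W. c \<cdot>\<^sub>v v \<in> W)"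
  by (auto simp: VectorSpace.subspace_def submodule_def vec_vs vec_module module_vec_simps)

lemma eq_mat_on_vecI:
  fixes A B :: "'a::semiring_1 mat"
  assumes A: "A \<in> carrier_mat m n" and B: "B \<in> carrier_mat m n"
    and eq: "\<And>v. v \<in> carrier_vec n \<Longrightarrow> A *\<^sub>v v = B *\<^sub>v v"
  shows "A = B"
proof (rule mat_col_eqI)
  fix j assume "j < dim_col B"
  then have j: "j < n" using B by simp
  then have "A *\<^sub>v unit_vec n j = col A j" "B *\<^sub>v unit_vec n j = col B j"
    using A B by (auto intro!: eq_vecI)
  then show "col A j = col B j" using eq[of "unit_vec n j"] by simp
qed (use A B in auto)

lemma mult_mat_zero_vec:
  fixes A :: "'a::semiring_1 mat"
  shows "A \<in> carrier_mat m n \<Longrightarrow> A *\<^sub>v 0\<^sub>v n = 0\<^sub>v m"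
  by (intro eq_vecI) auto

text \<open>Compare the traces of \<open>S T\<close> and \<open>T S\<close>.\<close>

lemma dim_eq_of_inverse:
  fixes S T :: "complex mat"
  assumes S: "S \<in> carrier_mat m n" and T: "T \<in> carrier_mat n m"
    and ST: "S * T = 1\<^sub>m m" and TS: "T * S = 1\<^sub>m n"
  shows "m = n"
proof -
  have "(\<Sum>i<m. (S * T) $$ (i, i)) = (\<Sum>i<m. \<Sum>j<n. S $$ (i, j) * T $$ (j, i))"
    using S T by (auto simp: scalar_prod_def atLeast0LessThan intro!: sum.cong)
  also have "\<dots> = (\<Sum>j<n. \<Sum>i<m. T $$ (j, i) * S $$ (i, j))"
    by (subst sum.swap) (simp add: mult.commute)
  also have "\<dots> = (\<Sum>j<n. (T * S) $$ (j, j))"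
    using S T by (auto simp: scalar_prod_def atLeast0LessThan intro!: sum.cong)
  finally show ?thesis by (simp add: ST TS)
qed

text \<open>Schur's lemma. The kernel and the range of an intertwiner are invariant subspaces, so a nonzero
  intertwiner of irreducible representations has trivial kernel and full range. Preimages of the
  unit vectors then form the columns of a two-sided inverse \<open>T\<close>.\<close>

theorem schur_equivalent:
  assumes \<Phi>: "irreducible_rep G n \<Phi>" and \<Psi>: "irreducible_rep G m \<Psi>"
    and S: "intertwines G n \<Phi> m \<Psi> S" and nz: "S \<noteq> 0\<^sub>m m n"
  shows "equivalent_reps G m \<Psi> n \<Phi>"
proof -
  have Sc [simp]: "S \<in> carrier_mat m n" and Si: "\<And>g. g \<in> carrier G \<Longrightarrow> \<Psi> g * S = S * \<Phi> g"
    using S by (auto simp: intertwines_def)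
  have r: "is_rep G n \<Phi>" "is_rep G m \<Psi>"
    using \<Phi> \<Psi> by (auto simp: irreducible_rep_def)
  note [simp] = rep_carrier[OF r(1)] rep_carrier[OF r(2)]
  have act: "\<Psi> g *\<^sub>v (S *\<^sub>v v) = S *\<^sub>v (\<Phi> g *\<^sub>v v)" if "g \<in> carrier G" "v \<in> carrier_vec n" for g v
    using that Si[OF that(1)] by (metis Sc assoc_mult_mat_vec rep_carrier r)
  have nz': "\<exists>v \<in> carrier_vec n. S *\<^sub>v v \<noteq> 0\<^sub>v m"
  proof (rule ccontr)
    assume "\<not> ?thesis"
    then have "S *\<^sub>v v = 0\<^sub>m m n *\<^sub>v v" if "v \<in> carrier_vec n" for v using that by auto
    then have "S = 0\<^sub>m m n" by (intro eq_mat_on_vecI[of _ m n]) auto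
    with nz show False by simp
  qed
  have S0: "S *\<^sub>v 0\<^sub>v n = 0\<^sub>v m"
    by (rule mult_mat_zero_vec[OF Sc])
  let ?K = "{v \<in> carrier_vec n. S *\<^sub>v v = 0\<^sub>v m}"
  have "VectorSpace.subspace class_ring ?K (module_vec TYPE(complex) n)"
    using S0 unfolding subspace_iff by (auto simp: mult_add_distrib_mat_vec[of _ m n] mult_mat_vec[of _ m n])
  moreover have "\<forall>g \<in> carrier G. \<forall>v \<in> ?K. \<Phi> g *\<^sub>v v \<in> ?K"
    using act[symmetric] mult_mat_zero_vec[OF rep_carrier[OF r(2)]] mult_mat_vec_carrier[OF rep_carrier[OF r(1)]]
    by auto
  ultimately have "?K = {0\<^sub>v n} \<or> ?K = carrier_vec n"
    using \<Phi> unfolding irreducible_rep_def by blast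
  then have K: "?K = {0\<^sub>v n}" using nz' by blast
  let ?R = "{S *\<^sub>v v |v. v \<in> carrier_vec n}"
  have "VectorSpace.subspace class_ring ?R (module_vec TYPE(complex) m)"
    unfolding subspace_iff
  proof (intro conjI ballI allI)
    show "?R \<subseteq> carrier_vec m" using mult_mat_vec_carrier[OF Sc] by auto
    show "0\<^sub>v m \<in> ?R" using S0 by (metis (mono_tags, lifting) mem_Collect_eq zero_carrier_vec)
    show "v + w \<in> ?R" if "v \<in> ?R" "w \<in> ?R" for v w
      using that by (auto simp: mult_add_distrib_mat_vec[of _ m n, symmetric])
    show "c \<cdot>\<^sub>v v \<in> ?R" if "v \<in> ?R" for c v
      using that by (auto simp: mult_mat_vec[of _ m n, symmetric])
  qed
  moreover have "\<forall>g \<in> carrier G. \<forall>v \<in> ?R. \<Psi> g *\<^sub>v v \<in> ?R"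
    using act mult_mat_vec_carrier[OF rep_carrier[OF r(1)]] by auto
  ultimately have "?R = {0\<^sub>v m} \<or> ?R = carrier_vec m"
    using \<Psi> unfolding irreducible_rep_def by blast
  then have R: "?R = carrier_vec m" using nz' by blast
  have "\<exists>p. \<forall>i. p i \<in> carrier_vec n \<and> (i < m \<longrightarrow> S *\<^sub>v p i = unit_vec m i)"
  proof (intro choice allI)
    fix i
    have "unit_vec m i \<in> ?R" unfolding R by simp
    then show "\<exists>v. v \<in> carrier_vec n \<and> (i < m \<longrightarrow> S *\<^sub>v v = unit_vec m i)" by force
  qed
  then obtain p where p: "\<And>i. p i \<in> carrier_vec n" "\<And>i. i < m \<Longrightarrow> S *\<^sub>v p i = unit_vec m i"
    by blast
  define T where "T = mat n m (\<lambda>(i, j). p j $ i)"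
  have T [simp]: "T \<in> carrier_mat n m" by (simp add: T_def)
  have colT: "col T j = p j" if "j < m" for j
    using that p(1)[of j] by (auto simp: T_def)
  have ST: "S * T = 1\<^sub>m m"
  proof (rule mat_col_eqI)
    fix j assume "j < dim_col (1\<^sub>m m :: complex mat)"
    then show "col (S * T) j = col (1\<^sub>m m) j"
      using p(2) colT by (simp add: col_mult2[of _ m n _ m])
  qed (use carrier_matD[OF Sc] carrier_matD[OF T] in auto)
  have "T * S = 1\<^sub>m n"
  proof (rule eq_mat_on_vecI[of _ n n])
    fix v :: "complex vec" assume v: "v \<in> carrier_vec n"
    have "S *\<^sub>v (T *\<^sub>v (S *\<^sub>v v)) = (S * T) *\<^sub>v (S *\<^sub>v v)"
      using v by (intro assoc_mult_mat_vec[symmetric, of _ m n _ m]) (auto intro: mult_mat_vec_carrier[OF Sc])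
    then have "S *\<^sub>v (T *\<^sub>v (S *\<^sub>v v)) = S *\<^sub>v v"
      using one_mult_mat_vec[OF mult_mat_vec_carrier[OF Sc v]] unfolding ST by simp
    then have "S *\<^sub>v (T *\<^sub>v (S *\<^sub>v v) - v) = 0\<^sub>v m"
      using v mult_mat_vec_carrier[OF Sc v] mult_mat_vec_carrier[OF T mult_mat_vec_carrier[OF Sc v]]
      by (simp add: mult_minus_distrib_mat_vec[OF Sc])
    moreover have "T *\<^sub>v (S *\<^sub>v v) - v \<in> carrier_vec n"
      using v by (intro minus_carrier_vec mult_mat_vec_carrier[OF T] mult_mat_vec_carrier[OF Sc])
    ultimately have d: "T *\<^sub>v (S *\<^sub>v v) - v = 0\<^sub>v n" using K by auto
    have "T *\<^sub>v (S *\<^sub>v v) = (T *\<^sub>v (S *\<^sub>v v) - v) + v"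
      using v carrier_matD[OF T] by (intro eq_vecI) auto
    also have "\<dots> = v" unfolding d using v by simp
    finally have "T *\<^sub>v (S *\<^sub>v v) = v" .
    then show "T * S *\<^sub>v v = 1\<^sub>m n *\<^sub>v v"
      using v assoc_mult_mat_vec[OF T Sc v] by simp
  qed (rule mult_carrier_mat[OF T Sc], rule one_carrier_mat)
  note TS = this
  have mn: "m = n" by (rule dim_eq_of_inverse[OF Sc T ST TS])
  have "T * \<Psi> g = \<Phi> g * T" if g: "g \<in> carrier G" for g
  proof -
    note p = rep_carrier[OF r(1) g] and q = rep_carrier[OF r(2) g]
    have "T * \<Psi> g = T * (\<Psi> g * (S * T))"
      unfolding ST right_mult_one_mat[OF q] ..
    also have "\<dots> = T * ((\<Psi> g * S) * T)" by (simp only: assoc_mult_mat[OF q Sc T])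
    also have "\<dots> = T * (S * (\<Phi> g * T))" by (simp only: Si[OF g] assoc_mult_mat[OF Sc p T])
    also have "\<dots> = (T * S) * (\<Phi> g * T)"
      by (simp only: assoc_mult_mat[OF T Sc mult_carrier_mat[OF p T]])
    finally show ?thesis
      by (simp only: TS left_mult_one_mat[OF mult_carrier_mat[OF p T]])
  qed
  moreover have "T \<in> carrier (GL m)"
    using ST TS T Sc mn unfolding in_GL_iff by blast
  ultimately show ?thesis using mn unfolding equivalent_reps_def by blast
qed

section \<open>Clock and shift matrices\<close>

lemma omega_cube: "\<omega> ^ 3 = 1"
proof -
  have "\<omega> ^ 3 = exp (\<i> * (complex_of_real pi * 2))"
    by (simp add: omega_def exp_of_nat_mult[symmetric] mult_ac)
  then show ?thesis by (simp only: exp_two_pi_i')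
qed

lemma omega_neq_1: "\<omega> \<noteq> 1"
proof
  assume "\<omega> = 1"
  then have "Re \<omega> = 1" by simp
  moreover have "Re \<omega> = cos (2 * pi / 3)" by (simp add: omega_def Re_exp)
  ultimately show False using cos_120 by simp
qed

lemma primitive_cube_root_sum:
  fixes \<zeta> :: complex assumes "\<zeta> ^ 3 = 1" "\<zeta> \<noteq> 1"
  shows "1 + \<zeta> + \<zeta>\<^sup>2 = 0"
proof -
  have "(\<zeta> - 1) * (1 + \<zeta> + \<zeta>\<^sup>2) = \<zeta> ^ 3 - 1"
    by (simp add: algebra_simps power2_eq_square power3_eq_cube)
  then show ?thesis using assms by simp
qed

lemma less_3_cases: "i < 3 \<Longrightarrow> i = 0 \<or> i = 1 \<or> i = (2::nat)"
  by auto

lemma sum_lt_3: "(\<Sum>i = 0..<3. f i) = f 0 + f 1 + f (2::nat)"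
  by (simp add: numeral_3_eq_3 numeral_2_eq_2)

text \<open>For \<open>\<zeta> = \<omega>\<^sup>\<epsilon>\<close> this is \<open>\<rho> \<eta>1\<close>, since then \<open>\<omega>\<^sup>-\<^sup>\<epsilon> = \<zeta>\<^sup>2\<close>. Clock and
  shift matrix, for a primitive \<open>\<zeta>\<close>, generate the algebra of all \<open>3 \<times> 3\<close> matrices.\<close>

definition clock_mat :: "complex \<Rightarrow> complex mat" where
  "clock_mat \<zeta> = mat_diag 3 (\<lambda>i. [1, \<zeta>\<^sup>2, \<zeta>] ! i)"

lemma clock_mat_carrier [simp]: "clock_mat \<zeta> \<in> carrier_mat 3 3"
  by (simp add: clock_mat_def)

lemma shift_mat_carrier [simp]: "shift_mat \<in> carrier_mat 3 3"
  by (auto simp: shift_mat_def mat_of_rows_list_def)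

lemma shift_mat_index:
  assumes "i < 3" "j < 3"
  shows "shift_mat $$ (i, j) = (if j = (i + 1) mod 3 then 1 else 0)"
  using less_3_cases[OF assms(1)] less_3_cases[OF assms(2)]
  by (elim disjE) (simp_all add: shift_mat_def mat_of_rows_list_def)

lemma clock_mult_left:
  "A \<in> carrier_mat 3 n \<Longrightarrow> i < 3 \<Longrightarrow> j < n \<Longrightarrow>
    (clock_mat \<zeta> * A) $$ (i, j) = [1, \<zeta>\<^sup>2, \<zeta>] ! i * A $$ (i, j)"
  by (simp add: clock_mat_def mat_diag_mult_left)

lemma clock_mult_right:
  "A \<in> carrier_mat n 3 \<Longrightarrow> i < n \<Longrightarrow> j < 3 \<Longrightarrow>
    (A * clock_mat \<zeta>) $$ (i, j) = A $$ (i, j) * [1, \<zeta>\<^sup>2, \<zeta>] ! j"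
  by (simp add: clock_mat_def mat_diag_mult_right)

lemma shift_mult_left:
  assumes "A \<in> carrier_mat 3 n" "i < 3" "j < n"
  shows "(shift_mat * A) $$ (i, j) = A $$ ((i + 1) mod 3, j)"
  using less_3_cases[OF assms(2)] assms(1,3) carrier_matD[OF shift_mat_carrier]
  by (elim disjE) (simp_all add: scalar_prod_def sum_lt_3 shift_mat_index numeral_2_eq_2)

lemma shift_mult_right:
  assumes "A \<in> carrier_mat n 3" "i < n" "j < 3"
  shows "(A * shift_mat) $$ (i, j) = A $$ (i, (j + 2) mod 3)"
  using less_3_cases[OF assms(3)] assms(1,2) carrier_matD[OF shift_mat_carrier]
  by (elim disjE) (simp_all add: scalar_prod_def sum_lt_3 shift_mat_index numeral_2_eq_2)

lemma clock_mat_index: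
  "i < 3 \<Longrightarrow> j < 3 \<Longrightarrow> clock_mat \<zeta> $$ (i, j) = (if i = j then [1, \<zeta>\<^sup>2, \<zeta>] ! j else 0)"
  by (simp add: clock_mat_def mat_diag_def)

lemma clock_mat_apply:
  assumes "v \<in> carrier_vec 3" "i < 3"
  shows "(clock_mat \<zeta> *\<^sub>v v) $ i = [1, \<zeta>\<^sup>2, \<zeta>] ! i * v $ i"
  using less_3_cases[OF assms(2)] assms(1) carrier_matD[OF clock_mat_carrier[of \<zeta>]]
  by (elim disjE) (simp_all add: scalar_prod_def sum_lt_3 clock_mat_index)

lemma shift_mat_apply:
  assumes "v \<in> carrier_vec 3" "i < 3"
  shows "(shift_mat *\<^sub>v v) $ i = v $ ((i + 1) mod 3)"
  using less_3_cases[OF assms(2)] assms(1) carrier_matD[OF shift_mat_carrier]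
  by (elim disjE) (simp_all add: scalar_prod_def sum_lt_3 shift_mat_index numeral_2_eq_2)

text \<open>The diagonal matrix has three distinct eigenvalues, so an invariant subspace contains, with any
  vector, its projections to the coordinate axes. A nonzero one thus contains a unit vector, and the
  shift produces the other two.\<close>

lemma clock_shift_irreducible:
  assumes \<zeta>: "\<zeta> ^ 3 = 1" "\<zeta> \<noteq> 1"
    and W: "VectorSpace.subspace class_ring W (module_vec TYPE(complex) 3)"
    and inv: "\<And>v. v \<in> W \<Longrightarrow> clock_mat \<zeta> *\<^sub>v v \<in> W" "\<And>v. v \<in> W \<Longrightarrow> shift_mat *\<^sub>v v \<in> W"
  shows "W = {0\<^sub>v 3} \<or> W = carrier_vec 3"
proof (cases "W = {0\<^sub>v 3}")
  case False
  note sum0 = primitive_cube_root_sum[OF \<zeta>]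
  have z4: "\<zeta> ^ 4 = \<zeta>" using \<zeta>(1) by (simp add: power_numeral_reduce)
  have W': "W \<subseteq> carrier_vec 3" "0\<^sub>v 3 \<in> W" "\<And>v w. v \<in> W \<Longrightarrow> w \<in> W \<Longrightarrow> v + w \<in> W"
      "\<And>c v. v \<in> W \<Longrightarrow> c \<cdot>\<^sub>v v \<in> W"
    using W unfolding subspace_iff by auto
  obtain v where v: "v \<in> W" "v \<noteq> 0\<^sub>v 3" using False W'(2) by blast
  have vc: "v \<in> carrier_vec 3" using v W' by auto
  obtain i where i: "i < 3" "v $ i \<noteq> 0"
    using v(2) vc by (metis carrier_vecD eq_vecI index_zero_vec)
  let ?D = "clock_mat \<zeta>"
  define v1 where "v1 = ?D *\<^sub>v v"
  define v2 where "v2 = ?D *\<^sub>v v1"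
  have v1: "v1 \<in> W" "v1 \<in> carrier_vec 3" and v2: "v2 \<in> W" "v2 \<in> carrier_vec 3"
    using inv(1) v(1) W'(1) by (auto simp: v1_def v2_def)
  \<comment> \<open>Averaging over the powers of \<open>\<zeta>\<^sup>i D\<close> projects to the eigenvalue \<open>\<zeta>\<^sup>-\<^sup>i\<close> of \<open>D\<close>, whose
    eigenvector is the unit vector of index \<open>i\<close>.\<close>
  let ?y = "v + \<zeta> ^ i \<cdot>\<^sub>v v1 + (\<zeta> ^ i)\<^sup>2 \<cdot>\<^sub>v v2"
  let ?e = "unit_vec 3 :: nat \<Rightarrow> complex vec"
  have "?y \<in> W" by (intro W' v v1 v2)
  have "?y $ j = 3 * v $ i * ?e i $ j" if "j < 3" for j
  proof -
    let ?d = "\<zeta> ^ i * [1, \<zeta>\<^sup>2, \<zeta>] ! j"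
    have "?y $ j = v $ j * (1 + ?d + ?d\<^sup>2)"
      using that vc v1(2) v2(2) clock_mat_apply[OF vc that, of \<zeta>, folded v1_def]
        clock_mat_apply[OF v1(2) that, of \<zeta>, folded v2_def]
      by (simp add: algebra_simps power2_eq_square)
    also have "1 + ?d + ?d\<^sup>2 = (if i = j then 3 else 0)"
      using less_3_cases[OF i(1)] less_3_cases[OF that] \<zeta>(1) sum0 z4
      by (elim disjE) (simp_all add: power_mult_distrib power2_eq_square power3_eq_cube power_numeral_reduce algebra_simps)
    finally show ?thesis using that i by auto
  qed
  then have "?y = (3 * v $ i) \<cdot>\<^sub>v ?e i"
    using vc v1(2) v2(2) by (intro eq_vecI) auto
  then have "?e i = inverse (3 * v $ i) \<cdot>\<^sub>v ?y" using i by (simp add: smult_smult_assoc)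
  then have e: "?e i \<in> W" using W'(4)[OF \<open>?y \<in> W\<close>] by simp
  have sh: "?e j \<in> W \<Longrightarrow> ?e (if j = 0 then 2 else j - 1) \<in> W" if "j < 3" for j
  proof -
    assume "?e j \<in> W"
    moreover have "shift_mat *\<^sub>v ?e j = ?e (if j = 0 then 2 else j - 1)"
    proof (rule eq_vecI)
      fix k assume "k < dim_vec (?e (if j = 0 then 2 else j - 1))"
      then have k: "k < 3" by simp
      show "(shift_mat *\<^sub>v ?e j) $ k = ?e (if j = 0 then 2 else j - 1) $ k"
        unfolding shift_mat_apply[OF unit_vec_carrier k]
        using less_3_cases[OF that] less_3_cases[OF k] by (elim disjE) (simp_all add: numeral_2_eq_2)
    qed (simp add: carrier_matD[OF shift_mat_carrier])
    ultimately show ?thesis using inv(2) by metis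
  qed
  have es: "?e 0 \<in> W" "?e 1 \<in> W" "?e 2 \<in> W"
    using less_3_cases[OF i(1)] e sh[of 0] sh[of 1] sh[of 2] by (elim disjE; simp)+
  have "x \<in> W" if "x \<in> carrier_vec 3" for x
  proof -
    have "x = x $ 0 \<cdot>\<^sub>v ?e 0 + x $ 1 \<cdot>\<^sub>v ?e 1 + x $ 2 \<cdot>\<^sub>v ?e 2"
    proof (rule eq_vecI)
      fix k assume "k < dim_vec (x $ 0 \<cdot>\<^sub>v ?e 0 + x $ 1 \<cdot>\<^sub>v ?e 1 + x $ 2 \<cdot>\<^sub>v ?e 2)"
      then have k: "k < 3" by simp
      show "x $ k = (x $ 0 \<cdot>\<^sub>v ?e 0 + x $ 1 \<cdot>\<^sub>v ?e 1 + x $ 2 \<cdot>\<^sub>v ?e 2) $ k"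
        using less_3_cases[OF k] by (elim disjE) simp_all
    qed (use that in simp)
    then show ?thesis using W' es by metis
  qed
  then show ?thesis using W' by auto
qed auto

text \<open>Commuting with a diagonal matrix with distinct entries forces \<open>T\<close> to be diagonal; commuting with
  the shift makes the diagonal constant.\<close>

lemma clock_shift_commutant:
  assumes \<zeta>: "\<zeta> ^ 3 = 1" "\<zeta> \<noteq> 1" and T: "T \<in> carrier_mat 3 3"
    and D: "T * clock_mat \<zeta> = clock_mat \<zeta> * T" and K: "T * shift_mat = shift_mat * T"
  shows "T = T $$ (0, 0) \<cdot>\<^sub>m 1\<^sub>m 3"
proof -
  have z: "\<zeta> \<noteq> 0" "\<zeta>\<^sup>2 \<noteq> 1" "\<zeta>\<^sup>2 \<noteq> \<zeta>"
    using \<zeta> by (auto simp: power2_eq_square power3_eq_cube)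
  have "T $$ (i, j) * [1, \<zeta>\<^sup>2, \<zeta>] ! j = [1, \<zeta>\<^sup>2, \<zeta>] ! i * T $$ (i, j)" if "i < 3" "j < 3" for i j
    using arg_cong[OF D, of "\<lambda>A. A $$ (i, j)"] that T
    by (simp only: clock_mult_left clock_mult_right)
  from this[of 0 1] this[of 0 2] this[of 1 0] this[of 1 2] this[of 2 0] this[of 2 1]
  have off: "T $$ (0, 1) = 0" "T $$ (0, 2) = 0" "T $$ (1, 0) = 0" "T $$ (1, 2) = 0"
      "T $$ (2, 0) = 0" "T $$ (2, 1) = 0"
    using z \<zeta>(2) by simp_all
  have sh: "T $$ (i, (j + 2) mod 3) = T $$ ((i + 1) mod 3, j)" if "i < 3" "j < 3" for i j
    using arg_cong[OF K, of "\<lambda>A. A $$ (i, j)"] that T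
    by (simp only: shift_mult_left shift_mult_right)
  have diag: "T $$ (1, 1) = T $$ (0, 0)" "T $$ (2, 2) = T $$ (0, 0)"
    using sh[of 0 1] sh[of 1 2] by (simp_all add: numeral_2_eq_2)
  show ?thesis
  proof (rule eq_matI)
    fix i j assume "i < dim_row (T $$ (0, 0) \<cdot>\<^sub>m 1\<^sub>m 3)" "j < dim_col (T $$ (0, 0) \<cdot>\<^sub>m 1\<^sub>m 3)"
    then have ij: "i < 3" "j < 3" by auto
    show "T $$ (i, j) = (T $$ (0, 0) \<cdot>\<^sub>m 1\<^sub>m 3) $$ (i, j)"
      using less_3_cases[OF ij(1)] less_3_cases[OF ij(2)] off diag by (elim disjE) simp_all
  qed (use T in auto)
qed

section \<open>Extending a representation by a normalizing element\<close>

lemma smult_smult_mat: "a \<cdot>\<^sub>m (b \<cdot>\<^sub>m A) = (a * b :: 'a::semigroup_mult) \<cdot>\<^sub>m A"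
  by (intro eq_matI) (auto simp: mult.assoc)

lemma smult_pow_mat:
  fixes A :: "'a::comm_semiring_1 mat"
  assumes "A \<in> carrier_mat n n"
  shows "(c \<cdot>\<^sub>m A) ^\<^sub>m k = c ^ k \<cdot>\<^sub>m (A ^\<^sub>m k)"
proof (induct k)
  case 0
  show ?case by (intro eq_matI) auto
next
  case (Suc k)
  have "A ^\<^sub>m k \<in> carrier_mat n n" using assms by simp
  then show ?case
    using assms Suc by (simp add: mult_smult_assoc_mat[of _ n n _ n] mult_smult_distrib[of _ n n _ n] smult_smult_mat mult_ac)
qed

lemma GL_pow:
  "A [^]\<^bsub>GL n\<^esub> (k::nat) = A ^\<^sub>m k" if "A \<in> carrier (GL n)"
  using that by (induct k) (auto dest: GL_carrier_mat)

text \<open>A representation of \<open>U\<close> extends to \<open>R = U \<rtimes> \<langle>\<eta>3\<rangle>\<close> as soon as some \<open>B\<close> with \<open>B\<^sup>3 = 1\<close> implements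
  the conjugation by \<open>\<eta>3\<close>. The three extensions of \<open>\<rho>\<close> come from the three choices
  \<open>B = \<omega>\<^sup>s J\<close>, which satisfy the same conditions as \<open>J\<close>.\<close>

locale cyclic_extension_rep = representation_group +
  fixes \<rho> :: "'a \<Rightarrow> complex mat" and B :: "complex mat" and n :: nat
  assumes rep_\<rho>: "is_rep (R\<lparr>carrier := U\<rparr>) n \<rho>"
    and B_GL: "B \<in> carrier (GL n)"
    and B_conj: "u \<in> U \<Longrightarrow> \<rho> (\<eta>3 \<otimes> u \<otimes> inv \<eta>3) * B = B * \<rho> u"
    and B_cube: "B ^\<^sub>m 3 = 1\<^sub>m n"
begin

lemma \<rho>_GL: "u \<in> U \<Longrightarrow> \<rho> u \<in> carrier (GL n)"
  using rep_\<rho> unfolding is_rep_def by (auto dest: hom_in_carrier)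

lemma \<rho>_carrier: "u \<in> U \<Longrightarrow> \<rho> u \<in> carrier_mat n n"
  using \<rho>_GL by (rule GL_carrier_mat)

lemma \<rho>_mult: "u \<in> U \<Longrightarrow> v \<in> U \<Longrightarrow> \<rho> (u \<otimes> v) = \<rho> u * \<rho> v"
  using rep_mult[OF rep_\<rho>] by simp

lemma B_carrier: "B \<in> carrier_mat n n"
  using B_GL by (rule GL_carrier_mat)

lemma B_pow_conj:
  "u \<in> U \<Longrightarrow> \<rho> (\<eta>3 [^] (k::nat) \<otimes> u \<otimes> inv (\<eta>3 [^] k)) * B ^\<^sub>m k = B ^\<^sub>m k * \<rho> u"
proof (induct k arbitrary: u)
  case 0
  then show ?case using U_closed \<rho>_carrier B_carrier
    by (simp add: left_mult_one_mat[OF \<rho>_carrier] right_mult_one_mat[OF \<rho>_carrier])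
next
  case (Suc k)
  let ?v = "\<eta>3 \<otimes> u \<otimes> inv \<eta>3"
  have v: "?v \<in> U" using conj_pow_in_U[OF Suc(2), of 1] by simp
  let ?c = "\<rho> (\<eta>3 [^] k \<otimes> ?v \<otimes> inv (\<eta>3 [^] k))"
  have c: "?c \<in> carrier_mat n n" "\<rho> ?v \<in> carrier_mat n n" "\<rho> u \<in> carrier_mat n n" "B ^\<^sub>m k \<in> carrier_mat n n"
    using \<rho>_carrier conj_pow_in_U[OF v] v Suc(2) B_carrier by auto
  note as = assoc_mult_mat[of _ n n _ n _ n]
  have "\<eta>3 [^] Suc k \<otimes> u \<otimes> inv (\<eta>3 [^] Suc k) = \<eta>3 [^] k \<otimes> ?v \<otimes> inv (\<eta>3 [^] k)"
    using U_closed[OF Suc(2)] by (simp add: inv_mult_group m_assoc)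
  then have "\<rho> (\<eta>3 [^] Suc k \<otimes> u \<otimes> inv (\<eta>3 [^] Suc k)) * B ^\<^sub>m Suc k = ?c * (B ^\<^sub>m k * B)" by simp
  also have "\<dots> = (?c * B ^\<^sub>m k) * B" using c B_carrier by (intro as[symmetric])
  also have "?c * B ^\<^sub>m k = B ^\<^sub>m k * \<rho> ?v" by (rule Suc(1)[OF v])
  also have "B ^\<^sub>m k * \<rho> ?v * B = B ^\<^sub>m k * (\<rho> ?v * B)" using c B_carrier by (intro as)
  also have "\<rho> ?v * B = B * \<rho> u" by (rule B_conj[OF Suc(2)])
  also have "B ^\<^sub>m k * (B * \<rho> u) = B ^\<^sub>m Suc k * \<rho> u" using c B_carrier by (simp add: as)
  finally show ?case .
qed

lemma B_pow_mod: "B ^\<^sub>m k = B ^\<^sub>m (k mod 3)"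
  using group.pow_mod[OF group_GL B_GL, of 3 k] by (simp add: GL_pow[OF B_GL] B_cube)

lemma B_pow_add: "B ^\<^sub>m (k + l) = B ^\<^sub>m k * B ^\<^sub>m l"
  using monoid.nat_pow_mult[OF group.is_monoid[OF group_GL] B_GL, of k l] by (simp add: GL_pow[OF B_GL])

text \<open>The assumption is for all \<open>k\<close> rather than for \<open>k < 3\<close>: exponents then add in a product
  without reduction modulo 3.\<close>

lemma extension_is_rep:
  assumes ext: "\<And>u k. u \<in> U \<Longrightarrow> \<Phi> (u \<otimes> \<eta>3 [^] (k::nat)) = \<rho> u * B ^\<^sub>m k"
  shows "is_rep R n \<Phi>"
  unfolding is_rep_def
proof (rule homI)
  interpret GL: group "GL n" by (rule group_GL)
  have dec: "\<exists>u \<in> U. \<exists>k::nat. x = u \<otimes> \<eta>3 [^] k" if "x \<in> carrier R" for x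
    using that unfolding bij_betw_imp_surj_on[OF decomposition, symmetric] by auto
  fix x assume "x \<in> carrier R"
  then obtain u k where u: "u \<in> U" and x: "x = u \<otimes> \<eta>3 [^] (k::nat)" using dec by blast
  have "\<rho> u * B ^\<^sub>m k \<in> carrier (GL n)"
    using GL.m_closed[OF \<rho>_GL[OF u] GL.nat_pow_closed[OF B_GL, of k]] by (simp add: GL_pow[OF B_GL])
  then show "\<Phi> x \<in> carrier (GL n)" using ext[OF u] x by simp
  fix y assume "y \<in> carrier R"
  then obtain v l where v: "v \<in> U" and y: "y = v \<otimes> \<eta>3 [^] (l::nat)" using dec by blast
  let ?v = "\<eta>3 [^] k \<otimes> v \<otimes> inv (\<eta>3 [^] k)"
  have v': "?v \<in> U" by (rule conj_pow_in_U[OF v])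
  have c: "\<rho> u \<in> carrier_mat n n" "\<rho> v \<in> carrier_mat n n" "\<rho> ?v \<in> carrier_mat n n"
      "B ^\<^sub>m k \<in> carrier_mat n n" "B ^\<^sub>m l \<in> carrier_mat n n"
    using u v v' \<rho>_carrier B_carrier by auto
  note as = assoc_mult_mat[of _ n n _ n _ n]
  have "x \<otimes> y = (u \<otimes> ?v) \<otimes> \<eta>3 [^] (k + l)"
    unfolding x y by (rule mult_pow_move) (use u v U_closed in auto)
  then have "\<Phi> (x \<otimes> y) = (\<rho> u * \<rho> ?v) * (B ^\<^sub>m k * B ^\<^sub>m l)"
    using ext[OF subgroup.m_closed[OF subgroup_U u v']] \<rho>_mult[OF u v'] B_pow_add by simp
  also have "\<dots> = \<rho> u * ((\<rho> ?v * B ^\<^sub>m k) * B ^\<^sub>m l)" using c by (simp add: as mult_carrier_mat[of _ n n _ n])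
  also have "\<rho> ?v * B ^\<^sub>m k = B ^\<^sub>m k * \<rho> v" by (rule B_pow_conj[OF v])
  also have "\<rho> u * ((B ^\<^sub>m k * \<rho> v) * B ^\<^sub>m l) = \<Phi> x * \<Phi> y"
    using c ext[OF u] ext[OF v] by (simp add: x y as mult_carrier_mat[of _ n n _ n])
  finally show "\<Phi> (x \<otimes> y) = \<Phi> x \<otimes>\<^bsub>GL n\<^esub> \<Phi> y" by simp
qed

end

section \<open>The three extensions\<close>

locale spin_extension = representation_group +
  fixes \<epsilon> \<mu> :: int and \<rho> :: "'a \<Rightarrow> complex mat" and J :: "complex mat"
  assumes eps: "\<epsilon> \<in> {1, -1}"
    and P: "is_P R z12 z23 \<eta>1 \<eta>2 \<epsilon> \<mu> \<rho>"
    and J: "is_J R U \<eta>3 \<rho> J"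
begin

definition \<zeta> where "\<zeta> = \<omega> powi \<epsilon>"

abbreviation \<Phi> where "\<Phi> \<equiv> Pi_rep R U \<eta>3 \<rho> J"

lemma zeta: "\<zeta> ^ 3 = 1" "\<zeta> \<noteq> 1" "\<omega> powi (- \<epsilon>) = \<zeta>\<^sup>2"
proof -
  show 1: "\<zeta> ^ 3 = 1" and "\<zeta> \<noteq> 1"
    using eps omega_cube omega_neq_1 by (auto simp: \<zeta>_def power_inverse)
  have "\<omega> powi (- \<epsilon>) = inverse \<zeta>" by (simp add: \<zeta>_def power_int_minus)
  also have "\<dots> = \<zeta>\<^sup>2"
  proof (rule inverse_unique)
    show "\<zeta> * \<zeta>\<^sup>2 = 1" using 1 by (simp add: power2_eq_square power3_eq_cube mult.assoc)
  qed
  finally show "\<omega> powi (- \<epsilon>) = \<zeta>\<^sup>2" .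
qed

lemma rho: "is_rep (R\<lparr>carrier := U\<rparr>) 3 \<rho>" "\<rho> z12 = \<zeta> \<cdot>\<^sub>m 1\<^sub>m 3" "\<rho> z23 = (\<omega> powi \<mu>) \<cdot>\<^sub>m 1\<^sub>m 3"
  "\<rho> \<eta>1 = clock_mat \<zeta>" "\<rho> \<eta>2 = shift_mat"
  using P by (simp_all add: is_P_def clock_mat_def zeta(3) \<zeta>_def[symmetric])

lemma J_props: "J \<in> carrier (GL 3)" "J \<in> carrier_mat 3 3" "J ^\<^sub>m 3 = 1\<^sub>m 3"
  "u \<in> U \<Longrightarrow> \<rho> (\<eta>3 \<otimes> u \<otimes> inv \<eta>3) * J = J * \<rho> u"
  using J GL_carrier_mat by (auto simp: is_J_def)

lemma twisted_extension: "cyclic_extension_rep R z12 z23 \<eta>1 \<eta>2 \<eta>3 \<rho> (\<omega> ^ s \<cdot>\<^sub>m J) 3"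
proof
  have w: "(\<omega> ^ s) ^ 3 = 1" by (metis omega_cube power_mult power_one mult.commute)
  then have w': "\<omega> ^ s * (\<omega> ^ s)\<^sup>2 = 1" by (simp add: power2_eq_square power3_eq_cube mult.assoc)
  show "is_rep (R\<lparr>carrier := U\<rparr>) 3 \<rho>" by (rule rho(1))
  show "(\<omega> ^ s \<cdot>\<^sub>m J) ^\<^sub>m 3 = 1\<^sub>m 3"
    using w J_props by (simp add: smult_pow_mat[of _ 3]) (intro eq_matI, auto)
  obtain K where K: "K \<in> carrier_mat 3 3" "K * J = 1\<^sub>m 3" "J * K = 1\<^sub>m 3"
    using J_props(1) unfolding in_GL_iff by auto
  have "((\<omega> ^ s)\<^sup>2 \<cdot>\<^sub>m K) * (\<omega> ^ s \<cdot>\<^sub>m J) = 1\<^sub>m 3" "(\<omega> ^ s \<cdot>\<^sub>m J) * ((\<omega> ^ s)\<^sup>2 \<cdot>\<^sub>m K) = 1\<^sub>m 3"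
    using K J_props(2) w'
    by (simp_all add: mult_smult_assoc_mat[of _ 3 3 _ 3] mult_smult_distrib[of _ 3 3 _ 3] smult_smult_mat mult_ac)
      (intro eq_matI; auto)+
  then show "\<omega> ^ s \<cdot>\<^sub>m J \<in> carrier (GL 3)"
    unfolding in_GL_iff using K(1) J_props(2) by (intro conjI bexI[of _ "(\<omega> ^ s)\<^sup>2 \<cdot>\<^sub>m K"]) auto
  fix u assume u: "u \<in> U"
  then have "\<rho> u \<in> carrier_mat 3 3" "\<rho> (\<eta>3 \<otimes> u \<otimes> inv \<eta>3) \<in> carrier_mat 3 3"
    using rep_carrier[OF rho(1)] conj_pow_in_U[OF u, of 1] by simp_all
  then show "\<rho> (\<eta>3 \<otimes> u \<otimes> inv \<eta>3) * (\<omega> ^ s \<cdot>\<^sub>m J) = \<omega> ^ s \<cdot>\<^sub>m J * \<rho> u"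
    using J_props(2) J_props(4)[OF u] by (simp add: mult_smult_assoc_mat[of _ 3 3 _ 3] mult_smult_distrib[of _ 3 3 _ 3])
qed

text \<open>The unique decomposition turns the definite description into a formula, which extends to all
  exponents \<open>k\<close> because both sides have period 3 in \<open>k\<close>.\<close>

lemma Pi_apply:
  assumes u: "u \<in> U"
  shows "\<Phi> s (u \<otimes> \<eta>3 [^] (k::nat)) = \<rho> u * (\<omega> ^ s \<cdot>\<^sub>m J) ^\<^sub>m k"
proof -
  interpret E: cyclic_extension_rep R z12 z23 \<eta>1 \<eta>2 \<eta>3 \<rho> "\<omega> ^ s \<cdot>\<^sub>m J" 3 by (rule twisted_extension)
  have val: "\<omega> ^ (s * j) \<cdot>\<^sub>m (\<rho> v * J ^\<^sub>m j) = \<rho> v * (\<omega> ^ s \<cdot>\<^sub>m J) ^\<^sub>m j" if "v \<in> U" for v j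
    using E.\<rho>_carrier[OF that] J_props(2)
    by (simp add: smult_pow_mat[of _ 3] mult_smult_distrib[of _ 3 3 _ 3] power_mult)
  have x: "u \<otimes> \<eta>3 [^] k = u \<otimes> \<eta>3 [^] (k mod 3)" using pow_mod[of \<eta>3 3 k] \<eta>_cubes by simp
  have uniq: "v = u \<and> j = k mod 3"
    if "v \<in> U" "j \<le> 2" "u \<otimes> \<eta>3 [^] k = v \<otimes> \<eta>3 [^] j" for v j
  proof -
    have "(u, k mod 3) = (v, j)"
      by (rule inj_onD[OF bij_betw_imp_inj_on[OF decomposition]]) (use that u x in auto)
    then show ?thesis by simp
  qed
  show ?thesis
    unfolding Pi_rep_def E.B_pow_mod[of k]
  proof (rule the_equality)
    show "\<exists>v\<in>U. \<exists>j\<le>2. u \<otimes> \<eta>3 [^] k = v \<otimes> \<eta>3 [^] j \<and>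
        \<rho> u * (\<omega> ^ s \<cdot>\<^sub>m J) ^\<^sub>m (k mod 3) = \<omega> ^ (s * j) \<cdot>\<^sub>m (\<rho> v * J ^\<^sub>m j)"
      using u x val[OF u] by (intro bexI[of _ u] exI[of _ "k mod 3"]) auto
  next
    fix A assume "\<exists>v\<in>U. \<exists>j\<le>2. u \<otimes> \<eta>3 [^] k = v \<otimes> \<eta>3 [^] j \<and> A = \<omega> ^ (s * j) \<cdot>\<^sub>m (\<rho> v * J ^\<^sub>m j)"
    then show "A = \<rho> u * (\<omega> ^ s \<cdot>\<^sub>m J) ^\<^sub>m (k mod 3)" using uniq val by auto
  qed
qed

lemma Pi_is_rep: "is_rep R 3 (\<Phi> s)"
  by (rule cyclic_extension_rep.extension_is_rep[OF twisted_extension Pi_apply])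

lemma Pi_U: "u \<in> U \<Longrightarrow> \<Phi> s u = \<rho> u"
  using Pi_apply[of u s 0] U_closed rep_carrier[OF rho(1), of u] J_props(2) by simp

lemma Pi_eta3: "\<Phi> s \<eta>3 = \<omega> ^ s \<cdot>\<^sub>m J"
proof -
  have "group (R\<lparr>carrier := U\<rparr>)" by (rule subgroup.subgroup_is_group[OF subgroup_U is_group])
  then have "\<rho> \<one> = 1\<^sub>m 3" using rep_one[OF _ rho(1)] by simp
  then show ?thesis
    using Pi_apply[OF subgroup.one_closed[OF subgroup_U], of s 1] J_props(2) by simp
qed

text \<open>The restriction to \<open>\<eta>1\<close> and \<open>\<eta>2\<close> alone is irreducible.\<close>

lemma Pi_spin_IR: "spin_IR R z12 z23 \<epsilon> \<mu> 3 (\<Phi> s)"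
proof -
  have "irreducible_rep R 3 (\<Phi> s)"
    unfolding irreducible_rep_def
  proof (intro conjI allI impI Pi_is_rep)
    fix W assume W: "VectorSpace.subspace class_ring W (module_vec TYPE(complex) 3)"
      and inv: "\<forall>g\<in>carrier R. \<forall>v\<in>W. \<Phi> s g *\<^sub>v v \<in> W"
    show "W = {0\<^sub>v 3} \<or> W = carrier_vec 3"
      using inv closed Pi_U gens_in_U rho
      by (intro clock_shift_irreducible[OF zeta(1,2) W]) metis+
  qed simp
  then show ?thesis using Pi_U gens_in_U rho unfolding spin_IR_def by (simp add: \<zeta>_def)
qed

text \<open>All \<open>\<Phi> s\<close> restrict to \<open>\<rho>\<close> on \<open>U\<close>, so an equivalence commutes with the clock and shift
  matrices and is a scalar. It then cannot change the factor \<open>\<omega>\<^sup>s\<close> at \<open>\<eta>3\<close>.\<close>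

lemma Pi_inequivalent:
  assumes "equivalent_reps R 3 (\<Phi> s) 3 (\<Phi> t)" and st: "s < 3" "t < 3"
  shows "s = t"
proof -
  obtain T where T: "T \<in> carrier (GL 3)" and i: "\<And>g. g \<in> carrier R \<Longrightarrow> T * \<Phi> s g = \<Phi> t g * T"
    using assms unfolding equivalent_reps_def by auto
  have Tc: "T \<in> carrier_mat 3 3" by (rule GL_carrier_mat[OF T])
  define c where "c = T $$ (0, 0)"
  have Ts: "T = c \<cdot>\<^sub>m 1\<^sub>m 3" unfolding c_def
    by (rule clock_shift_commutant[OF zeta(1,2) Tc])
      (use i[of \<eta>1] i[of \<eta>2] in \<open>simp_all add: Pi_U gens_in_U rho\<close>)
  have c0: "c \<noteq> 0"
  proof
    assume "c = 0"
    then have "T = 0\<^sub>m 3 3" using Ts by (intro eq_matI) auto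
    then have "(0\<^sub>m 3 3 :: complex mat) = 1\<^sub>m 3" using T unfolding in_GL_iff by force
    from arg_cong[OF this, of "\<lambda>A. A $$ (0, 0)"] show False by simp
  qed
  have "T * (\<omega> ^ s \<cdot>\<^sub>m J) = (\<omega> ^ t \<cdot>\<^sub>m J) * T" using i[of \<eta>3] by (simp add: Pi_eta3)
  moreover have "T * (\<omega> ^ s \<cdot>\<^sub>m J) = (c * \<omega> ^ s) \<cdot>\<^sub>m J" "(\<omega> ^ t \<cdot>\<^sub>m J) * T = (c * \<omega> ^ t) \<cdot>\<^sub>m J"
    using J_props(2) unfolding Ts
    by (simp_all add: mult_smult_assoc_mat[of _ 3 3 _ 3] mult_smult_distrib[of _ 3 3 _ 3] smult_smult_mat mult_ac)
  ultimately have "(c * \<omega> ^ s) \<cdot>\<^sub>m J = (c * \<omega> ^ t) \<cdot>\<^sub>m J" by simp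
  then have e: "c * \<omega> ^ s * J $$ (i, j) = c * \<omega> ^ t * J $$ (i, j)" if "i < 3" "j < 3" for i j
    using that J_props(2) by (metis carrier_matD index_smult_mat(1))
  have "\<exists>i<3. \<exists>j<3. J $$ (i, j) \<noteq> 0"
  proof (rule ccontr)
    assume "\<not> ?thesis"
    then have "J = 0\<^sub>m 3 3" using J_props(2) by (intro eq_matI) auto
    then have "(0\<^sub>m 3 3 :: complex mat) = 1\<^sub>m 3" using J_props(1) unfolding in_GL_iff by force
    from arg_cong[OF this, of "\<lambda>A. A $$ (0, 0)"] show False by simp
  qed
  then have w: "\<omega> ^ s = \<omega> ^ t" using e c0 by auto
  have "\<omega> \<noteq> 0" "\<omega>\<^sup>2 \<noteq> 1" "\<omega>\<^sup>2 \<noteq> \<omega>"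
    using omega_cube omega_neq_1 by (auto simp: power2_eq_square power3_eq_cube)
  then show ?thesis
    using w less_3_cases[OF st(1)] less_3_cases[OF st(2)] omega_neq_1 by auto
qed

end

section \<open>Every representation of the spin type is one of the three\<close>

text \<open>The orthogonality of the three characters of the cyclic group of order 3: the three sums are the
  spectral projections of an operator of order 3, up to a factor, and they add up to \<open>3 x\<close>.\<close>

lemma cube_root_average_zero:
  fixes x y z \<zeta> :: complex
  assumes "\<zeta> ^ 3 = 1" "\<zeta> \<noteq> 1"
    and "x + y + z = 0" "x + \<zeta> * y + \<zeta>\<^sup>2 * z = 0" "x + \<zeta>\<^sup>2 * y + \<zeta> * z = 0"
  shows "x = 0"
proof -
  have "(x + y + z) + (x + \<zeta> * y + \<zeta>\<^sup>2 * z) + (x + \<zeta>\<^sup>2 * y + \<zeta> * z)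
      = 3 * x + (1 + \<zeta> + \<zeta>\<^sup>2) * (y + z)"
    by (simp add: algebra_simps)
  then show ?thesis using assms primitive_cube_root_sum[OF assms(1,2)] by simp
qed

lemma pow_mat_3_apply:
  fixes A :: "complex mat"
  assumes "A \<in> carrier_mat n n" "v \<in> carrier_vec n"
  shows "A ^\<^sub>m 3 *\<^sub>v v = A *\<^sub>v (A *\<^sub>v (A *\<^sub>v v))"
  using assms by (simp add: numeral_3_eq_3 assoc_mult_mat_vec[of _ n n _ n] mult_mat_vec_carrier[of _ n n])

lemma commutation_apply:
  fixes A B :: "complex mat"
  assumes A: "A \<in> carrier_mat n n" and B: "B \<in> carrier_mat n n"
    and AB: "A * B = \<zeta> \<cdot>\<^sub>m (B * A)" and v: "v \<in> carrier_vec n"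
  shows "A *\<^sub>v (B *\<^sub>v v) = \<zeta> \<cdot>\<^sub>v (B *\<^sub>v (A *\<^sub>v v))"
proof -
  have BA: "B * A \<in> carrier_mat n n" using A B by simp
  have "A *\<^sub>v (B *\<^sub>v v) = (A * B) *\<^sub>v v" using v A B by simp
  also have "\<dots> = \<zeta> \<cdot>\<^sub>v ((B * A) *\<^sub>v v)"
    unfolding AB using v carrier_matD[OF BA] by (intro eq_vecI) auto
  finally show ?thesis using v A B by simp
qed

text \<open>The matrix \<open>B\<close> permutes the eigenspaces of \<open>A\<close> cyclically, multiplying eigenvalues by \<open>\<zeta>\<close>. As
  \<open>A\<^sup>3 = 1\<close>, some eigenvalue \<open>1\<close>, \<open>\<zeta>\<close> or \<open>\<zeta>\<^sup>2\<close> occurs, and hence all of them do. The proof runs this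
  backwards: if 1 is not an eigenvalue, then all three spectral projections vanish.\<close>

lemma commutation_fixed_vector:
  fixes A B :: "complex mat"
  assumes \<zeta>: "\<zeta> ^ 3 = 1" "\<zeta> \<noteq> 1" and n: "n > 0"
    and A: "A \<in> carrier_mat n n" and B: "B \<in> carrier_mat n n"
    and A3: "A ^\<^sub>m 3 = 1\<^sub>m n" and B3: "B ^\<^sub>m 3 = 1\<^sub>m n"
    and AB: "A * B = \<zeta> \<cdot>\<^sub>m (B * A)"
  shows "\<exists>v \<in> carrier_vec n. v \<noteq> 0\<^sub>v n \<and> A *\<^sub>v v = v"
proof (rule ccontr)
  assume "\<not> ?thesis"
  then have nofix: "v = 0\<^sub>v n" if "v \<in> carrier_vec n" "A *\<^sub>v v = v" for v using that by auto
  note [simp] = mult_mat_vec_carrier[OF A] mult_mat_vec_carrier[OF B]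
  have cube: "M *\<^sub>v (M *\<^sub>v (M *\<^sub>v v)) = v"
    if "M \<in> carrier_mat n n" "M ^\<^sub>m 3 = 1\<^sub>m n" "v \<in> carrier_vec n" for M and v :: "complex vec"
    using pow_mat_3_apply[OF that(1,3)] that by simp
  \<comment> \<open>Up to a factor, \<open>q c\<close> is the projection to the eigenvalue \<open>c\<inverse>\<close> of \<open>A\<close>.\<close>
  define q where "q c v = v + c \<cdot>\<^sub>v (A *\<^sub>v v) + c\<^sup>2 \<cdot>\<^sub>v (A *\<^sub>v (A *\<^sub>v v))" for c v
  have qc: "q c v \<in> carrier_vec n" if "v \<in> carrier_vec n" for c v
    using that by (simp add: q_def)
  have q1: "q 1 v = 0\<^sub>v n" if v: "v \<in> carrier_vec n" for v
  proof (rule nofix[OF qc[OF v]])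
    have "A *\<^sub>v q 1 v = A *\<^sub>v v + A *\<^sub>v (A *\<^sub>v v) + A *\<^sub>v (A *\<^sub>v (A *\<^sub>v v))"
      using v by (simp add: q_def mult_add_distrib_mat_vec[OF A] assoc_add_vec[of _ n])
    also have "\<dots> = A *\<^sub>v v + A *\<^sub>v (A *\<^sub>v v) + v" by (simp add: cube[OF A A3 v])
    also have "\<dots> = q 1 v" using v carrier_vecD[OF mult_mat_vec_carrier[OF A]] A
      unfolding q_def by (intro eq_vecI) (auto simp: add_ac simp del: index_mult_mat_vec)
    finally show "A *\<^sub>v q 1 v = q 1 v" .
  qed
  note comm = commutation_apply[OF A B AB]
  have qB: "q c (B *\<^sub>v v) = B *\<^sub>v q (c * \<zeta>) v" if v: "v \<in> carrier_vec n" for c v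
  proof -
    have "A *\<^sub>v (A *\<^sub>v (B *\<^sub>v v)) = \<zeta>\<^sup>2 \<cdot>\<^sub>v (B *\<^sub>v (A *\<^sub>v (A *\<^sub>v v)))"
      using v comm[OF v] comm[of "A *\<^sub>v v"]
      by (simp add: mult_mat_vec[OF A] smult_smult_assoc power2_eq_square)
    then show ?thesis
      using v comm[OF v]
      by (simp add: q_def assoc_add_vec[of _ n] mult_add_distrib_mat_vec[OF B] mult_mat_vec[OF B] smult_smult_assoc power_mult_distrib)
  qed
  have shift: "q (c * \<zeta>) v = 0\<^sub>v n" if "\<And>w. w \<in> carrier_vec n \<Longrightarrow> q c w = 0\<^sub>v n" "v \<in> carrier_vec n" for c v
  proof -
    have "B *\<^sub>v q (c * \<zeta>) v = 0\<^sub>v n" using that(1)[of "B *\<^sub>v v"] that(2) qB[OF that(2), of c] by simp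
    then have "B *\<^sub>v (B *\<^sub>v (B *\<^sub>v q (c * \<zeta>) v)) = 0\<^sub>v n" by (simp add: mult_mat_zero_vec[OF B])
    then show ?thesis using cube[OF B B3 qc[OF that(2)]] by simp
  qed
  have z: "q \<zeta> v = 0\<^sub>v n" "q (\<zeta>\<^sup>2) v = 0\<^sub>v n" if "v \<in> carrier_vec n" for v :: "complex vec"
    using shift[OF q1] shift[OF shift[OF q1]] that by (simp_all add: power2_eq_square)
  have "v = 0\<^sub>v n" if v: "v \<in> carrier_vec n" for v :: "complex vec"
  proof (rule eq_vecI)
    fix i assume "i < dim_vec (0\<^sub>v n :: complex vec)"
    then have i: "i < n" by simp
    define a where "a = A *\<^sub>v v"
    define b where "b = A *\<^sub>v a"
    have ab: "a \<in> carrier_vec n" "b \<in> carrier_vec n" using v by (simp_all add: a_def b_def)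
    have qi: "q c v $ i = v $ i + c * a $ i + c\<^sup>2 * b $ i" for c
      using i v ab unfolding q_def a_def[symmetric] b_def[symmetric] by simp
    have z4: "(\<zeta>\<^sup>2)\<^sup>2 = \<zeta>" using \<zeta>(1) by (simp add: power2_eq_square power3_eq_cube mult.assoc)
    have "v $ i = 0"
    proof (rule cube_root_average_zero[OF \<zeta>])
      show "v $ i + a $ i + b $ i = 0" using qi[of 1] q1[OF v] i by simp
      show "v $ i + \<zeta> * a $ i + \<zeta>\<^sup>2 * b $ i = 0" using qi[of \<zeta>] z(1)[OF v] i by simp
      show "v $ i + \<zeta>\<^sup>2 * a $ i + \<zeta> * b $ i = 0"
        using qi[of "\<zeta>\<^sup>2"] z(2)[OF v] i unfolding z4 by simp
    qed
    then show "v $ i = 0\<^sub>v n $ i" using i by simp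
  qed (use v in simp)
  from this[of "unit_vec n 0"] have "unit_vec n 0 $ 0 = (0\<^sub>v n $ 0 :: complex)" by simp
  then show False using n by simp
qed

text \<open>If \<open>v\<close> is fixed by \<open>A\<close>, then \<open>v\<close>, \<open>B v\<close>, \<open>B\<^sup>2 v\<close> are eigenvectors for \<open>1\<close>, \<open>\<zeta>\<close>, \<open>\<zeta>\<^sup>2\<close>. The
  clock matrix lists its eigenvalues in the order \<open>1, \<zeta>\<^sup>2, \<zeta>\<close>, and the shift maps the unit vectors
  by \<open>e\<^sub>0 \<mapsto> e\<^sub>2 \<mapsto> e\<^sub>1 \<mapsto> e\<^sub>0\<close>; hence the columns \<open>v\<close>, \<open>B\<^sup>2 v\<close>, \<open>B v\<close>.\<close>

lemma clock_shift_intertwiner: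
  fixes A B :: "complex mat"
  assumes \<zeta>: "\<zeta> ^ 3 = 1" "\<zeta> \<noteq> 1" and n: "n > 0"
    and A: "A \<in> carrier_mat n n" and B: "B \<in> carrier_mat n n"
    and A3: "A ^\<^sub>m 3 = 1\<^sub>m n" and B3: "B ^\<^sub>m 3 = 1\<^sub>m n"
    and AB: "A * B = \<zeta> \<cdot>\<^sub>m (B * A)"
  shows "\<exists>S \<in> carrier_mat n 3. S \<noteq> 0\<^sub>m n 3 \<and> A * S = S * clock_mat \<zeta> \<and> B * S = S * shift_mat"
proof -
  obtain v where v: "v \<in> carrier_vec n" "v \<noteq> 0\<^sub>v n" "A *\<^sub>v v = v"
    using commutation_fixed_vector[OF assms] by blast
  note [simp] = mult_mat_vec_carrier[OF A] mult_mat_vec_carrier[OF B]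
  define w where "w = B *\<^sub>v v"
  define x where "x = B *\<^sub>v w"
  have wx: "w \<in> carrier_vec n" "x \<in> carrier_vec n" using v by (simp_all add: w_def x_def)
  have Bx: "B *\<^sub>v x = v"
    using pow_mat_3_apply[OF B v(1)] B3 v(1) by (simp add: w_def x_def)
  note comm = commutation_apply[OF A B AB]
  have Aw: "A *\<^sub>v w = \<zeta> \<cdot>\<^sub>v w" using comm[OF v(1)] v(3) by (simp add: w_def)
  have Ax: "A *\<^sub>v x = \<zeta>\<^sup>2 \<cdot>\<^sub>v x"
    using comm[OF wx(1)] Aw wx(1) by (simp add: x_def mult_mat_vec[OF B] smult_smult_assoc power2_eq_square)
  define S where "S = mat n 3 (\<lambda>(i, j). [v, x, w] ! j $ i)"
  have S: "S \<in> carrier_mat n 3" by (simp add: S_def)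
  have col: "col S j = [v, x, w] ! j" if "j < 3" for j
    using less_3_cases[OF that] v wx by (elim disjE) (auto simp: S_def intro!: eq_vecI)
  have prod: "(M * S) $$ (i, j) = (M *\<^sub>v ([v, x, w] ! j)) $ i"
    if "M \<in> carrier_mat n n" "i < n" "j < 3" for M i j
    using that S col[OF that(3)] by simp
  have "A * S = S * clock_mat \<zeta>"
  proof (rule eq_matI)
    fix i j assume "i < dim_row (S * clock_mat \<zeta>)" "j < dim_col (S * clock_mat \<zeta>)"
    then have ij: "i < n" "j < 3" using S carrier_matD[OF clock_mat_carrier[of \<zeta>]] by auto
    show "(A * S) $$ (i, j) = (S * clock_mat \<zeta>) $$ (i, j)"
      unfolding prod[OF A ij] clock_mult_right[OF S ij]
      using less_3_cases[OF ij(2)] ij(1) v wx Aw Ax by (elim disjE) (simp_all add: S_def)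
  qed (use S A carrier_matD[OF clock_mat_carrier[of \<zeta>]] in auto)
  moreover have "B * S = S * shift_mat"
  proof (rule eq_matI)
    fix i j assume "i < dim_row (S * shift_mat)" "j < dim_col (S * shift_mat)"
    then have ij: "i < n" "j < 3" using S carrier_matD[OF shift_mat_carrier] by auto
    show "(B * S) $$ (i, j) = (S * shift_mat) $$ (i, j)"
      unfolding prod[OF B ij] shift_mult_right[OF S ij]
      using less_3_cases[OF ij(2)] ij(1) Bx w_def[symmetric] x_def[symmetric] by (elim disjE) (simp_all add: S_def)
  qed (use S B carrier_matD[OF shift_mat_carrier] in auto)
  moreover have "S \<noteq> 0\<^sub>m n 3"
  proof
    assume "S = 0\<^sub>m n 3"
    then have "col S 0 = 0\<^sub>v n" by (intro eq_vecI) auto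
    then show False using col[of 0] v(2) by simp
  qed
  ultimately show ?thesis using S by blast
qed

context spin_extension
begin

text \<open>The spin type turns the relation between \<open>\<eta>1\<close> and \<open>\<eta>2\<close> into a commutation up to the scalar \<open>\<zeta>\<close>,
  so \<open>\<rho>\<close> occurs in the restriction to \<open>U\<close> of every representation of this spin type.\<close>

lemma spin_IR_restriction:
  assumes "spin_IR R z12 z23 \<epsilon> \<mu> n \<Psi>"
  shows "\<exists>S \<in> carrier_mat n 3. S \<noteq> 0\<^sub>m n 3 \<and> (\<forall>u \<in> U. \<Psi> u * S = S * \<rho> u)"
proof -
  have r: "is_rep R n \<Psi>" "n > 0" and z: "\<Psi> z12 = \<zeta> \<cdot>\<^sub>m 1\<^sub>m n" "\<Psi> z23 = (\<omega> powi \<mu>) \<cdot>\<^sub>m 1\<^sub>m n"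
    using assms by (auto simp: spin_IR_def irreducible_rep_def \<zeta>_def)
  note c = rep_carrier[OF r(1)] and m = rep_mult[OF r(1)]
  have cube: "\<Psi> g ^\<^sub>m 3 = 1\<^sub>m n" if "g \<in> carrier R" "g [^] (3::nat) = \<one>" for g
    using that m[symmetric] rep_one[OF is_group r(1)] left_mult_one_mat[OF c]
    by (simp add: numeral_3_eq_3)
  have "\<eta>1 \<otimes> \<eta>2 = z12 \<otimes> (\<eta>2 \<otimes> \<eta>1)"
    using conj_\<eta>2 by (metis closed inv_solve_right m_assoc m_closed inv_closed)
  then have "\<Psi> \<eta>1 * \<Psi> \<eta>2 = \<Psi> z12 * (\<Psi> \<eta>2 * \<Psi> \<eta>1)" by (simp add: m[symmetric])
  also have "\<dots> = \<zeta> \<cdot>\<^sub>m (\<Psi> \<eta>2 * \<Psi> \<eta>1)"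
    using mult_carrier_mat[OF c[of \<eta>2] c[of \<eta>1]] left_mult_one_mat[of "\<Psi> \<eta>2 * \<Psi> \<eta>1" n n]
    by (simp add: z mult_smult_assoc_mat[of _ n n _ n])
  finally have AB: "\<Psi> \<eta>1 * \<Psi> \<eta>2 = \<zeta> \<cdot>\<^sub>m (\<Psi> \<eta>2 * \<Psi> \<eta>1)" .
  obtain S where S: "S \<in> carrier_mat n 3" "S \<noteq> 0\<^sub>m n 3"
      "\<Psi> \<eta>1 * S = S * clock_mat \<zeta>" "\<Psi> \<eta>2 * S = S * shift_mat"
    using clock_shift_intertwiner[OF zeta(1,2) r(2) c c cube cube AB] \<eta>_cubes by auto
  let ?R = "R\<lparr>carrier := U\<rparr>"
  have sc: "(a \<cdot>\<^sub>m 1\<^sub>m n) * S = S * (a \<cdot>\<^sub>m 1\<^sub>m 3)" for a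
    using S(1) by (simp add: mult_smult_assoc_mat[of _ n n _ 3] mult_smult_distrib[of _ n 3 _ 3])
  have "intertwines ?R 3 \<rho> n \<Psi> S"
  proof (rule intertwines_if_on_generators[where H = "{z12, \<eta>1, \<eta>2, z23}"])
    show "group ?R" by (rule subgroup.subgroup_is_group[OF subgroup_U is_group])
    show "is_rep ?R n \<Psi>" using r(1) U_closed unfolding is_rep_def by (auto simp: hom_def)
    show "{z12, \<eta>1, \<eta>2, z23} \<subseteq> carrier ?R" using gens_in_U by simp
    show "generate ?R {z12, \<eta>1, \<eta>2, z23} = carrier ?R"
      using generate_consistent[OF _ subgroup_U, of "{z12, \<eta>1, \<eta>2, z23}"] gens_in_U by (simp add: U_tilde_def)
  qed (use S z rho sc in auto)
  then show ?thesis using S by (auto simp: intertwines_def)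
qed

text \<open>Frobenius reciprocity in explicit form. The map \<open>F X = \<Psi>(\<eta>3) X J\<inverse>\<close> sends intertwiners of the
  restrictions to \<open>U\<close> to such intertwiners and satisfies \<open>F\<^sup>3 = 1\<close>; its eigenvectors for the
  eigenvalue \<open>\<omega>\<^sup>s\<close> are the intertwiners from \<open>\<Phi> s\<close> to \<open>\<Psi>\<close>. The spectral projections of a nonzero
  \<open>S\<close> add up to \<open>S\<close>, so one of them is nonzero, and Schur's lemma applies to it.\<close>

lemma Pi_complete:
  assumes \<Psi>: "spin_IR R z12 z23 \<epsilon> \<mu> n \<Psi>"
  shows "\<exists>s \<in> {0, 1, 2}. equivalent_reps R n \<Psi> 3 (\<Phi> s)"
proof -
  have irr: "irreducible_rep R n \<Psi>" using \<Psi> by (simp add: spin_IR_def)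
  then have r: "is_rep R n \<Psi>" by (simp add: irreducible_rep_def)
  note c = rep_carrier[OF r] and m = rep_mult[OF r]
  define C where "C = \<Psi> \<eta>3"
  \<comment> \<open>The inverse of \<open>J\<close>, as \<open>J\<^sup>3 = 1\<close>.\<close>
  define K where "K = J * J"
  have C: "C \<in> carrier_mat n n" by (simp add: C_def c)
  have Jc: "J \<in> carrier_mat 3 3" by (rule J_props(2))
  have K: "K \<in> carrier_mat 3 3" using Jc by (simp add: K_def)
  have KJ: "K * J = 1\<^sub>m 3" "J * K = 1\<^sub>m 3"
    using J_props(3) Jc by (simp_all add: K_def numeral_3_eq_3 assoc_mult_mat[of _ 3 3 _ 3 _ 3])
  have KKK: "K * (K * K) = 1\<^sub>m 3"
  proof -
    have "K * (K * K) = K * (K * (J * J))" by (simp add: K_def)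
    also have "\<dots> = K * ((K * J) * J)" using K Jc by (simp add: assoc_mult_mat[of _ 3 3 _ 3 _ 3])
    finally show ?thesis using KJ Jc by simp
  qed
  have CCC: "C * (C * C) = 1\<^sub>m n"
  proof -
    have "\<eta>3 \<otimes> (\<eta>3 \<otimes> \<eta>3) = \<one>" using \<eta>_cubes(3) by (simp add: numeral_3_eq_3 m_assoc)
    then show ?thesis using rep_one[OF is_group r] by (simp add: C_def m[symmetric])
  qed
  define F where "F X = C * X * K" for X
  have Fc: "F X \<in> carrier_mat n 3" if "X \<in> carrier_mat n 3" for X
    using that C K by (auto simp: F_def intro!: mult_carrier_mat)
  have FFF: "F (F (F X)) = X" if X: "X \<in> carrier_mat n 3" for X
  proof -
    have "F (F (F X)) = (C * (C * C)) * X * (K * (K * K))"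
      using X C K by (simp add: F_def assoc_mult_mat[of _ n n _ n _ n] assoc_mult_mat[of _ n n _ n _ 3]
          assoc_mult_mat[of _ n n _ 3 _ 3] assoc_mult_mat[of _ n 3 _ 3 _ 3] assoc_mult_mat[of _ 3 3 _ 3 _ 3]
          mult_carrier_mat[of _ n n _ 3] mult_carrier_mat[of _ n 3 _ 3] mult_carrier_mat[of _ n n _ n] mult_carrier_mat[of _ 3 3 _ 3])
    then show ?thesis using X CCC KKK by simp
  qed
  let ?I = "{X \<in> carrier_mat n 3. \<forall>u \<in> U. \<Psi> u * X = X * \<rho> u}"
  have F_I: "F X \<in> ?I" if X: "X \<in> ?I" for X
  proof -
    have Xc: "X \<in> carrier_mat n 3" using X by simp
    have "\<Psi> u * F X = F X * \<rho> u" if u: "u \<in> U" for u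
    proof -
      \<comment> \<open>This is \<open>\<eta>3\<inverse> u \<eta>3\<close>, written with the square so that it visibly lies in \<open>U\<close>.\<close>
      define v where "v = \<eta>3 [^] (2::nat) \<otimes> u \<otimes> inv (\<eta>3 [^] (2::nat))"
      have v: "v \<in> U" unfolding v_def by (rule conj_pow_in_U[OF u])
      have uc: "u \<in> carrier R" "v \<in> carrier R" using u v U_closed by auto
      have e3: "\<eta>3 \<otimes> \<eta>3 [^] (2::nat) = \<one>"
        using \<eta>_cubes(3) by (simp add: numeral_3_eq_3 numeral_2_eq_2 m_assoc)
      have "\<eta>3 \<otimes> v \<otimes> inv \<eta>3 = (\<eta>3 \<otimes> \<eta>3 [^] (2::nat)) \<otimes> u \<otimes> inv (\<eta>3 \<otimes> \<eta>3 [^] (2::nat))"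
        using uc by (simp add: v_def m_assoc inv_mult_group pow_mult_distrib)
      then have uv: "\<eta>3 \<otimes> v \<otimes> inv \<eta>3 = u" using uc by (simp add: e3)
      then have "u \<otimes> \<eta>3 = \<eta>3 \<otimes> v" using uc by (metis closed(5) inv_solve_right' m_closed)
      then have 1: "\<Psi> u * C = C * \<Psi> v" using uc by (simp add: C_def m[symmetric])
      have rc: "\<rho> u \<in> carrier_mat 3 3" "\<rho> v \<in> carrier_mat 3 3"
        using rep_carrier[OF rho(1)] u v by auto
      have "\<rho> u * J = J * \<rho> v" using J_props(4)[OF v] uv by simp
      then have "K * (\<rho> u * J) * K = K * (J * \<rho> v) * K" by simp
      moreover have "K * (\<rho> u * J) * K = K * \<rho> u"
        using K Jc rc KJ by (simp add: assoc_mult_mat[of _ 3 3 _ 3 _ 3])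
      moreover have "K * (J * \<rho> v) * K = \<rho> v * K"
      proof -
        have "K * (J * \<rho> v) = (K * J) * \<rho> v" using K Jc rc by (intro assoc_mult_mat[symmetric])
        then show ?thesis using rc KJ by simp
      qed
      ultimately have 2: "\<rho> v * K = K * \<rho> u" by simp
      have "\<Psi> u * F X = (\<Psi> u * C) * (X * K)"
        using C K Xc c[OF uc(1)] by (simp add: F_def assoc_mult_mat[of _ n n _ n _ 3] assoc_mult_mat[of _ n n _ 3 _ 3]
          mult_carrier_mat[of _ n 3 _ 3])
      also have "\<dots> = C * ((\<Psi> v * X) * K)" unfolding 1
        using C K Xc c[OF uc(2)] by (simp add: assoc_mult_mat[of _ n n _ n _ 3] assoc_mult_mat[of _ n n _ 3 _ 3]
          mult_carrier_mat[of _ n 3 _ 3])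
      also have "\<Psi> v * X = X * \<rho> v" using X v by simp
      also have "C * ((X * \<rho> v) * K) = C * (X * (\<rho> v * K))"
        using Xc rc K by (simp add: assoc_mult_mat[of _ n 3 _ 3 _ 3])
      also have "\<dots> = F X * \<rho> u" unfolding 2
        using C K Xc rc by (simp add: F_def assoc_mult_mat[of _ n n _ 3 _ 3] assoc_mult_mat[of _ n 3 _ 3 _ 3]
          mult_carrier_mat[of _ n 3 _ 3] mult_carrier_mat[of _ 3 3 _ 3])
      finally show ?thesis .
    qed
    then show ?thesis using Fc[OF Xc] by simp
  qed
  obtain S where S: "S \<in> ?I" "S \<noteq> 0\<^sub>m n 3" using spin_IR_restriction[OF \<Psi>] by auto
  \<comment> \<open>Three times the projection of \<open>S\<close> to the eigenvalue \<open>\<omega>\<^sup>s\<close> of \<open>F\<close>; note \<open>\<omega>\<^sup>2\<^sup>s = \<omega>\<^sup>-\<^sup>s\<close>.\<close>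
  define Y where "Y s = S + (\<omega> ^ (2 * s)) \<cdot>\<^sub>m F S + (\<omega> ^ s) \<cdot>\<^sub>m F (F S)" for s :: nat
  have Sc: "S \<in> carrier_mat n 3" "F S \<in> carrier_mat n 3" "F (F S) \<in> carrier_mat n 3"
    using S F_I by auto
  have Yc: "Y s \<in> carrier_mat n 3" for s using Sc by (simp add: Y_def)
  have "\<exists>s \<in> {0, 1, 2}. Y s \<noteq> 0\<^sub>m n 3"
  proof (rule ccontr)
    assume "\<not> ?thesis"
    then have 0: "Y 0 = 0\<^sub>m n 3" "Y 1 = 0\<^sub>m n 3" "Y 2 = 0\<^sub>m n 3" by auto
    have "S = 0\<^sub>m n 3"
    proof (rule eq_matI)
      fix i j assume "i < dim_row (0\<^sub>m n 3 :: complex mat)" "j < dim_col (0\<^sub>m n 3 :: complex mat)"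
      then have ij: "i < n" "j < 3" by auto
      have y: "Y s $$ (i, j) = S $$ (i, j) + \<omega> ^ (2 * s) * F S $$ (i, j) + \<omega> ^ s * F (F S) $$ (i, j)" for s
        using Sc ij by (simp add: Y_def)
      have w4: "\<omega> ^ 4 = \<omega>" using omega_cube by (simp add: power_numeral_reduce)
      have "S $$ (i, j) = 0"
      proof (rule cube_root_average_zero[OF omega_cube omega_neq_1])
        show "S $$ (i, j) + F S $$ (i, j) + F (F S) $$ (i, j) = 0"
          using y[of 0] ij unfolding 0 by simp
        show "S $$ (i, j) + \<omega> * F S $$ (i, j) + \<omega>\<^sup>2 * F (F S) $$ (i, j) = 0"
          using y[of 2] ij unfolding 0 by (simp add: w4)
        show "S $$ (i, j) + \<omega>\<^sup>2 * F S $$ (i, j) + \<omega> * F (F S) $$ (i, j) = 0"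
          using y[of 1] ij unfolding 0 by simp
      qed
      then show "S $$ (i, j) = 0\<^sub>m n 3 $$ (i, j)" using ij by simp
    qed (use Sc in auto)
    then show False using S by simp
  qed
  then obtain s where s: "s \<in> {0, 1, 2}" "Y s \<noteq> 0\<^sub>m n 3" by blast
  have ws: "(\<omega> ^ s) ^ 3 = 1" by (metis omega_cube power_mult power_one mult.commute)
  have F_Y: "F (Y s) = \<omega> ^ s \<cdot>\<^sub>m Y s"
  proof -
    have lin: "F (X + Z) = F X + F Z" "F (a \<cdot>\<^sub>m X) = a \<cdot>\<^sub>m F X"
      if "X \<in> carrier_mat n 3" "Z \<in> carrier_mat n 3" for X Z a
      using that C K mult_carrier_mat[OF C that(1)] mult_carrier_mat[OF C that(2)]
      by (simp_all add: F_def mult_add_distrib_mat[of _ n n _ 3] add_mult_distrib_mat[of _ n 3 _ _ 3]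
          mult_smult_distrib[of _ n n _ 3] mult_smult_assoc_mat[of _ n 3 _ 3])
    have "F (Y s) = F S + (\<omega> ^ (2 * s)) \<cdot>\<^sub>m F (F S) + (\<omega> ^ s) \<cdot>\<^sub>m S"
      using Sc FFF[OF Sc(1)] by (simp add: Y_def lin)
    also have "\<dots> = \<omega> ^ s \<cdot>\<^sub>m Y s"
    proof (rule eq_matI)
      fix i j assume "i < dim_row (\<omega> ^ s \<cdot>\<^sub>m Y s)" "j < dim_col (\<omega> ^ s \<cdot>\<^sub>m Y s)"
      then have ij: "i < n" "j < 3" using Yc[of s] by auto
      have w3: "\<omega> ^ s * \<omega> ^ (2 * s) = 1" "\<omega> ^ s * \<omega> ^ s = \<omega> ^ (2 * s)"
        using ws by (simp_all add: power_add[symmetric] power_mult[symmetric] mult.commute flip: mult_2)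
      have "\<omega> ^ s * Y s $$ (i, j) = \<omega> ^ s * S $$ (i, j) + (\<omega> ^ s * \<omega> ^ (2 * s)) * F S $$ (i, j)
          + (\<omega> ^ s * \<omega> ^ s) * F (F S) $$ (i, j)"
        using Sc ij by (simp add: Y_def algebra_simps)
      then show "(F S + (\<omega> ^ (2 * s)) \<cdot>\<^sub>m F (F S) + (\<omega> ^ s) \<cdot>\<^sub>m S) $$ (i, j) = (\<omega> ^ s \<cdot>\<^sub>m Y s) $$ (i, j)"
        unfolding w3 using Sc ij Yc[of s] by simp
    qed (use Sc Yc[of s] in auto)
    finally show ?thesis .
  qed
  have CY: "C * Y s = Y s * (\<omega> ^ s \<cdot>\<^sub>m J)"
  proof -
    have "F (Y s) * J = C * Y s * (K * J)"
      using C K Jc Yc[of s] mult_carrier_mat[OF C Yc[of s]] unfolding F_def by (intro assoc_mult_mat)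
    also have "\<dots> = C * Y s" unfolding KJ by (rule right_mult_one_mat[OF mult_carrier_mat[OF C Yc]])
    finally show ?thesis
      using Yc[of s] Jc by (simp add: F_Y mult_smult_assoc_mat[of _ n 3 _ 3] mult_smult_distrib[of _ n 3 _ 3])
  qed
  have YU: "\<Psi> u * Y s = Y s * \<rho> u" if u: "u \<in> U" for u
  proof -
    have uc: "\<Psi> u \<in> carrier_mat n n" "\<rho> u \<in> carrier_mat 3 3"
      using c[OF U_closed[OF u]] rep_carrier[OF rho(1)] u by auto
    have "\<Psi> u * S = S * \<rho> u" "\<Psi> u * F S = F S * \<rho> u" "\<Psi> u * F (F S) = F (F S) * \<rho> u"
      using S F_I u by auto
    then show ?thesis
      using uc Sc by (simp add: Y_def mult_add_distrib_mat[of _ n n _ 3] add_mult_distrib_mat[of _ n 3 _ _ 3]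
          mult_smult_distrib[of _ n n _ 3] mult_smult_assoc_mat[of _ n 3 _ 3])
  qed
  have "intertwines R 3 (\<Phi> s) n \<Psi> (Y s)"
  proof (rule intertwines_if_on_generators[OF is_group Pi_is_rep r Yc gens_closed generated])
    fix h assume "h \<in> {z12, z23, \<eta>1, \<eta>2, \<eta>3}"
    then show "\<Psi> h * Y s = Y s * \<Phi> s h"
      using YU gens_in_U CY by (auto simp: Pi_U Pi_eta3 C_def)
  qed
  then have "equivalent_reps R n \<Psi> 3 (\<Phi> s)"
    using Pi_spin_IR[of s] s(2) by (intro schur_equivalent[OF _ irr]) (auto simp: spin_IR_def)
  then show ?thesis using s(1) by blast
qed

end

theorem theorem7p6:
  fixes R (structure) and z12 z23 \<eta>1 \<eta>2 \<eta>3 :: 'g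
    and \<epsilon> \<mu> :: int
    and \<rho> :: "'g \<Rightarrow> complex mat" and Jw :: "complex mat"
  assumes "representation_group R z12 z23 \<eta>1 \<eta>2 \<eta>3"
    and "\<epsilon> \<in> {1, -1}" and "\<mu> \<in> {1, -1}"
    and "is_P R z12 z23 \<eta>1 \<eta>2 \<epsilon> \<mu> \<rho>"
    and "is_J R (U_tilde R z12 z23 \<eta>1 \<eta>2) \<eta>3 \<rho> Jw"
  shows "let \<Phi> = Pi_rep R (U_tilde R z12 z23 \<eta>1 \<eta>2) \<eta>3 \<rho> Jw in
    (\<forall>s \<in> {0, 1, 2}. spin_IR R z12 z23 \<epsilon> \<mu> 3 (\<Phi> s)) \<and>
    (\<forall>s \<in> {0, 1, 2}. \<forall>t \<in> {0, 1, 2}. equivalent_reps R 3 (\<Phi> s) 3 (\<Phi> t) \<longrightarrow> s = t) \<and>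
    (\<forall>n \<Psi>. spin_IR R z12 z23 \<epsilon> \<mu> n \<Psi> \<longrightarrow>
       (\<exists>s \<in> {0, 1, 2}. equivalent_reps R n \<Psi> 3 (\<Phi> s)))"
proof -
  interpret representation_group R z12 z23 \<eta>1 \<eta>2 \<eta>3 by fact
  interpret spin_extension R z12 z23 \<eta>1 \<eta>2 \<eta>3 \<epsilon> \<mu> \<rho> Jw
    by unfold_locales (use assms in auto)
  show ?thesis
    unfolding Let_def
  proof (intro conjI ballI allI impI)
    fix s t :: nat
    assume "s \<in> {0, 1, 2}" "t \<in> {0, 1, 2}"
      and "equivalent_reps R 3 (Pi_rep R U \<eta>3 \<rho> Jw s) 3 (Pi_rep R U \<eta>3 \<rho> Jw t)"
    then show "s = t" by (intro Pi_inequivalent) auto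
  qed (use Pi_spin_IR Pi_complete in auto)
qed

end
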